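(* Let $a_{-1},a_0,a_1,a_2,b>0$ and $\gamma,\theta>1$ be constants, let $x_0>0$, and let $\{Y_t\}_{t\ge0}$ be the unique positive global solution of $$dY_t=f(Y_t)\,dt+b(1-\theta)\,dW_t,\qquad Y_0=x_0^{1-\theta}.$$ Suppose that one of the following two conditions holds: (i) $\gamma+1>2\theta$ and $p\ge\frac{2}{\theta-1}$; (ii) $\gamma+1=2\theta$ and $\frac{2}{\theta-1}\le p\le\frac{2a_2+b^2}{(\theta-1)b^2}$. Then $$\sup_{t\in[0,\infty)}\mathbb E\big[|Y_t|^{-p}\big]<\infty.$$
   Context: $\{W_t\}_{t\ge0}$ is a one-dimensional Brownian motion on a filtered probability space $(\Omega,\mathcal F,\{\mathcal F_t\}_{t\ge0},\mathbb P)$ satisfying the usual hypotheses. The drift $f:(0,\infty)\to\mathbb R$ is $$f(x)=(\theta-1)\Big(a_2x^{\frac{\gamma-\theta}{1-\theta}}-a_1x-a_{-1}x^{\frac{\theta+1}{\theta-1}}+a_0x^{\frac{\theta}{\theta-1}}+\tfrac12 b^2\theta x^{-1}\Big).$$ The equation is known to have a unique positive global solution for these parameters. *)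

theory Defs
  imports "HOL-Probability.Probability"
begin

(* Time is the half-line [0,\<infinity>) inside the type real: a filtration or process is a function on
   real whose values at negative times are irrelevant and unconstrained. *)

locale usual_filtered_prob_space = prob_space M
  for M :: "'a measure" +
  fixes F :: "real \<Rightarrow> 'a measure"
  assumes filtration_subalgebra: "\<And>t. 0 \<le> t \<Longrightarrow> subalgebra M (F t)"
    and filtration_mono: "\<And>s t. 0 \<le> s \<Longrightarrow> s \<le> t \<Longrightarrow> sets (F s) \<subseteq> sets (F t)"
    and right_continuous: "\<And>t. 0 \<le> t \<Longrightarrow> sets (F t) = (\<Inter>s\<in>{t<..}. sets (F s))"
    and complete: "complete_measure M"
    and null_sets_initial: "null_sets M \<subseteq> sets (F 0)"

locale brownian_motion = usual_filtered_prob_space M F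
  for M :: "'a measure" and F :: "real \<Rightarrow> 'a measure" +
  fixes W :: "real \<Rightarrow> 'a \<Rightarrow> real"
  assumes adapted: "\<And>t. 0 \<le> t \<Longrightarrow> W t \<in> borel_measurable (F t)"
    and start_zero: "AE \<omega> in M. W 0 \<omega> = 0"
    and continuous_paths: "AE \<omega> in M. continuous_on {0..} (\<lambda>t. W t \<omega>)"
    and increment_normal: "\<And>s t. 0 \<le> s \<Longrightarrow> s < t \<Longrightarrow>
      distributed M lborel (\<lambda>\<omega>. W t \<omega> - W s \<omega>) (normal_density 0 (sqrt (t - s)))"
    and increment_indep: "\<And>s t. 0 \<le> s \<Longrightarrow> s < t \<Longrightarrow>
      indep_set (sets (F s)) (sets (vimage_algebra (space M) (\<lambda>\<omega>. W t \<omega> - W s \<omega>) borel))"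

(* Positive global (strong) solution of dY = g(Y) dt + \<sigma> dW, Y_0 = y0, for a constant \<sigma>. The
   stochastic integral of the constant \<sigma> over [0,t] is \<sigma> (W_t - W_0), so the integral form of the
   equation is an identity between continuous paths. *)

definition positive_global_solution ::
  "'a measure \<Rightarrow> (real \<Rightarrow> 'a measure) \<Rightarrow> (real \<Rightarrow> 'a \<Rightarrow> real) \<Rightarrow> (real \<Rightarrow> real) \<Rightarrow> real \<Rightarrow> real
    \<Rightarrow> (real \<Rightarrow> 'a \<Rightarrow> real) \<Rightarrow> bool" where
  "positive_global_solution M F W g \<sigma> y0 Y \<longleftrightarrow>
     (\<forall>t\<ge>0. Y t \<in> borel_measurable (F t)) \<and>
     (AE \<omega> in M.
        continuous_on {0..} (\<lambda>t. Y t \<omega>) \<and>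
        Y 0 \<omega> = y0 \<and>
        (\<forall>t\<ge>0. Y t \<omega> > 0 \<and>
           set_integrable lborel {0..t} (\<lambda>s. g (Y s \<omega>)) \<and>
           Y t \<omega> = y0 + (LBINT s:{0..t}. g (Y s \<omega>)) + \<sigma> * (W t \<omega> - W 0 \<omega>)))"

(* Only the values at x > 0 are meaningful. *)

definition drift ::
  "real \<Rightarrow> real \<Rightarrow> real \<Rightarrow> real \<Rightarrow> real \<Rightarrow> real \<Rightarrow> real \<Rightarrow> real \<Rightarrow> real" where
  "drift a_m1 a0 a1 a2 b \<gamma> \<theta> x =
     (\<theta> - 1) * (a2 * x powr ((\<gamma> - \<theta>) / (1 - \<theta>)) - a1 * x - a_m1 * x powr ((\<theta> + 1) / (\<theta> - 1))
       + a0 * x powr (\<theta> / (\<theta> - 1)) + 1 / 2 * b\<^sup>2 * \<theta> * inverse x)"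

end

theory Submission
  imports Defs
begin

text \<open>
  The moments are controlled by a Lyapunov function. Write \<open>\<Gamma> V = V' f + (c\<^sup>2 / 2) V''\<close> with
  \<open>c = b (1 - \<theta>)\<close> for the generator of the diffusion. If \<open>V > 0\<close> satisfies
  \<open>\<Gamma> V \<le> C - \<epsilon> V\<close> on the half-line, then \<open>E (V (Y t)) \<le> V (Y 0) + C / \<epsilon>\<close> for every \<open>t\<close>
  (\<open>lyapunov_moment_bound\<close>), and any such \<open>V\<close> above \<open>x\<^sup>-\<^sup>p\<close> gives the claim.

  Choice of \<open>V\<close> (\<open>drift_lyapunov_condition\<close>). The generator maps a power of \<open>x\<close> to a sum of
  powers, so only the behaviour at \<open>0\<close> and at infinity matters. At infinity the drift
  is strongly negative, and adding \<open>x\<^sup>2\<close> to \<open>V\<close> yields a negative term that dominates all others.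
  At \<open>0\<close> the critical case is \<open>\<gamma> + 1 = 2 \<theta>\<close>, where drift and noise both contribute to
  the power \<open>x\<^sup>-\<^sup>p\<^sup>-\<^sup>2\<close>. The upper bound on \<open>p\<close> says that its coefficient is not positive, but at the
  endpoint it vanishes, and \<open>\<Gamma> x\<^sup>-\<^sup>p\<close> then behaves near \<open>0\<close> like a positive multiple of \<open>x\<^sup>-\<^sup>p\<close>. Adding
  \<open>x\<^sup>-\<^sup>q\<close> with \<open>p - 2 < q < p\<close> repairs this: the coefficient belonging to \<open>q\<close> is strictly
  negative, and \<open>x\<^sup>-\<^sup>q\<^sup>-\<^sup>2\<close> dominates \<open>x\<^sup>-\<^sup>p\<close> near \<open>0\<close>. In the case \<open>\<gamma> + 1 > 2 \<theta>\<close> the term with \<open>a2\<close> is the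
  most singular one and has the right sign for every \<open>p > 0\<close>.

  The moment bound is proved without stochastic calculus. Because the noise coefficient is
  constant, \<open>Y\<close> differs from a multiple of \<open>W\<close> by an ordinary integral along each path, and a second-order
  Taylor expansion over a grid of mesh \<open>h = t / N\<close> needs only the Gaussian moments of the increments and
  their independence of the past. The coefficients are bounded on the event that \<open>Y\<close> has stayed in a compact
  interval \<open>{l..u}\<close>. The one-step estimate has to pass from this event at the end of a step to the larger event
  at its beginning (\<open>localized_step\<close>); that is possible because the Taylor
  majorant of the positive function \<open>V\<close>, with a large cubic remainder, is itself nonnegative
  (\<open>cubic_majorant_pos\<close>), so that it can be integrated over the larger event. A discrete
  Gronwall inequality adds up the steps; the accumulated error tends to \<open>0\<close> as \<open>N\<close> grows, and Fatou's
  lemma removes the localisation.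
\<close>

section \<open>Increments of Brownian motion\<close>

lemma (in brownian_motion) borel_measurable_F_imp_M:
  fixes X :: "'a \<Rightarrow> real"
  assumes "0 \<le> t" "X \<in> borel_measurable (F t)"
  shows "X \<in> borel_measurable M"
  using measurable_from_subalg[OF filtration_subalgebra[OF assms(1)] assms(2)] .

lemma (in brownian_motion) borel_measurable_F_mono:
  fixes X :: "'a \<Rightarrow> real"
  assumes "0 \<le> s" "s \<le> t" "X \<in> borel_measurable (F s)"
  shows "X \<in> borel_measurable (F t)"
proof -
  have "subalgebra (F t) (F s)"
    using filtration_subalgebra[of s] filtration_subalgebra[of t] filtration_mono[of s t] assms
    by (auto simp: subalgebra_def)
  then show ?thesis
    using assms(3) by (rule measurable_from_subalg)
qed

lemma (in brownian_motion) measurable_W: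
  assumes "0 \<le> t"
  shows "W t \<in> borel_measurable M"
  using borel_measurable_F_imp_M[OF assms adapted[OF assms]] .

text \<open>The filtration, and not the process \<open>W\<close> alone, is independent of the future increment, so \<open>X\<close> may
  depend on the solution \<open>Y\<close> up to time \<open>s\<close>.\<close>

lemma (in brownian_motion) indep_var_increment:
  assumes st: "0 \<le> s" "s < t"
    and X: "X \<in> borel_measurable (F s)" and \<phi>: "\<phi> \<in> borel_measurable borel"
  shows "indep_var borel (X :: 'a \<Rightarrow> real) borel (\<lambda>\<omega>. \<phi> (W t \<omega> - W s \<omega>) :: real)"
proof -
  let ?\<xi> = "\<lambda>\<omega>. W t \<omega> - W s \<omega>"
  let ?V = "vimage_algebra (space M) ?\<xi> borel"
  have sF: "space (F s) = space M" "sets (F s) \<subseteq> sets M"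
    using filtration_subalgebra[of s] st by (auto simp: subalgebra_def)
  have mX: "X \<in> borel_measurable M"
    using borel_measurable_F_imp_M[OF st(1) X] .
  have m\<xi>: "?\<xi> \<in> borel_measurable M"
    using measurable_W[of s] measurable_W[of t] st by simp
  have m\<phi>: "(\<lambda>\<omega>. \<phi> (?\<xi> \<omega>)) \<in> borel_measurable M"
    using measurable_compose[OF m\<xi> \<phi>] .
  have m\<phi>V: "(\<lambda>\<omega>. \<phi> (?\<xi> \<omega>)) \<in> borel_measurable ?V"
    using measurable_compose[OF measurable_vimage_algebra1 \<phi>, of ?\<xi> "space M"] by simp
  have sub: "sigma_sets (space M) {Z -` A \<inter> space M |A. A \<in> sets borel} \<subseteq> sets N"
    if "space N = space M" "Z \<in> borel_measurable N" for Z :: "'a \<Rightarrow> real" and N :: "'a measure"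
    using sets.sigma_sets_subset[of "{Z -` A \<inter> space N |A. A \<in> sets borel}" N]
      measurable_sets[OF that(2)] that(1) by auto
  have 1: "sigma_sets (space M) {X -` A \<inter> space M |A. A \<in> sets borel} \<subseteq> sets (F s)"
    using sF(1) X by (rule sub)
  have 2: "sigma_sets (space M) {(\<lambda>\<omega>. \<phi> (?\<xi> \<omega>)) -` A \<inter> space M |A. A \<in> sets borel} \<subseteq> sets ?V"
    by (rule sub[OF _ m\<phi>V]) simp
  show ?thesis
    unfolding indep_var_eq
  proof (intro conjI mX m\<phi>)
    show "indep_set (sigma_sets (space M) {X -` A \<inter> space M |A. A \<in> sets borel})
        (sigma_sets (space M) {(\<lambda>\<omega>. \<phi> (?\<xi> \<omega>)) -` A \<inter> space M |A. A \<in> sets borel})"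
      using increment_indep[OF st] 1 2 unfolding indep_sets2_eq by blast
  qed
qed

lemma (in brownian_motion) increment_moments:
  assumes st: "0 \<le> s" "s < t"
  defines "\<xi> \<equiv> \<lambda>\<omega>. W t \<omega> - W s \<omega>"
  shows "has_bochner_integral M \<xi> 0"
    and "has_bochner_integral M (\<lambda>\<omega>. (\<xi> \<omega>)\<^sup>2) (t - s)"
    and "has_bochner_integral M (\<lambda>\<omega>. \<bar>\<xi> \<omega>\<bar>) (sqrt (2 / pi) * sqrt (t - s))"
    and "has_bochner_integral M (\<lambda>\<omega>. \<bar>\<xi> \<omega>\<bar> ^ 3) (2 * sqrt (2 / pi) * sqrt (t - s) ^ 3)"
proof -
  let ?d = "normal_density 0 (sqrt (t - s))"
  have D: "distributed M lborel \<xi> ?d"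
    unfolding \<xi>_def by (rule increment_normal[OF st])
  have pos: "0 < sqrt (t - s)" using st by simp
  have transfer: "has_bochner_integral M (\<lambda>\<omega>. \<phi> (\<xi> \<omega>)) m"
    if "has_bochner_integral lborel (\<lambda>x. ?d x * \<phi> x) m" "\<phi> \<in> borel_measurable borel"
    for \<phi> :: "real \<Rightarrow> real" and m
    using that distributed_integrable[OF D, of \<phi>] distributed_integral[OF D, of \<phi>]
    by (simp add: has_bochner_integral_iff)
  show "has_bochner_integral M \<xi> 0"
    using normal_moment_odd[OF pos, of 0 0] by (intro transfer) simp_all
  show "has_bochner_integral M (\<lambda>\<omega>. (\<xi> \<omega>)\<^sup>2) (t - s)"
  proof (intro transfer)
    have "(sqrt (t - s))\<^sup>2 = t - s" using st by simp
    then have "fact (2 * 1) / ((2 / (sqrt (t - s))\<^sup>2) ^ 1 * fact 1) = t - s"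
      by (simp only: fact_2 power_one_right fact_1 mult_1_right) simp
    then show "has_bochner_integral lborel (\<lambda>x. ?d x * x\<^sup>2) (t - s)"
      using normal_moment_even[OF pos, of 0 1] by (simp only: diff_zero mult_1_right)
  qed simp
  show "has_bochner_integral M (\<lambda>\<omega>. \<bar>\<xi> \<omega>\<bar>) (sqrt (2 / pi) * sqrt (t - s))"
    using normal_moment_abs_odd[OF pos, of 0 0] by (intro transfer) (simp_all add: mult.commute)
  show "has_bochner_integral M (\<lambda>\<omega>. \<bar>\<xi> \<omega>\<bar> ^ 3) (2 * sqrt (2 / pi) * sqrt (t - s) ^ 3)"
    using normal_moment_abs_odd[OF pos, of 0 1]
    by (intro transfer) (simp_all add: eval_nat_numeral mult_ac)
qed

text \<open>This replaces the martingale property of the stochastic integral: an adapted factor can be pulled out, and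
  with \<open>increment_moments\<close> the linear term of a Taylor expansion disappears while the quadratic one
  contributes \<open>t - s\<close>.\<close>

lemma (in brownian_motion) has_bochner_integral_times_increment:
  fixes X :: "'a \<Rightarrow> real" and \<phi> :: "real \<Rightarrow> real"
  assumes st: "0 \<le> s" "s < t"
    and X: "X \<in> borel_measurable (F s)" "integrable M X"
    and \<phi>: "\<phi> \<in> borel_measurable borel" "has_bochner_integral M (\<lambda>\<omega>. \<phi> (W t \<omega> - W s \<omega>)) m"
  shows "has_bochner_integral M (\<lambda>\<omega>. X \<omega> * \<phi> (W t \<omega> - W s \<omega>)) (expectation X * m)"
proof -
  have ind: "indep_var borel X borel (\<lambda>\<omega>. \<phi> (W t \<omega> - W s \<omega>))"
    using indep_var_increment[OF st X(1) \<phi>(1)] .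
  note \<phi>_int = has_bochner_integral_iff[THEN iffD1, OF \<phi>(2)]
  show ?thesis
    unfolding has_bochner_integral_iff
    using indep_var_integrable[OF ind X(2)] indep_var_lebesgue_integral[OF ind X(2)] \<phi>_int by simp
qed

section \<open>Deterministic estimates for one time step\<close>

text \<open>The dissipation \<open>\<epsilon> h (u 0 + C / \<epsilon> + S)\<close> gained at the level of the bound, where \<open>S\<close> is the sum of the
  errors so far, already compensates the forcing \<open>C h\<close>. Hence the bound does not grow with \<open>N\<close>.\<close>

lemma discrete_gronwall:
  fixes u e :: "nat \<Rightarrow> real"
  assumes h: "0 \<le> h" "0 < \<epsilon>" "\<epsilon> * h \<le> 1" and C: "0 \<le> C" and u0: "0 \<le> u 0"
    and e: "\<And>i. i < N \<Longrightarrow> 0 \<le> e i"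
    and step: "\<And>i. i < N \<Longrightarrow> u (Suc i) \<le> (1 - \<epsilon> * h) * u i + C * h + e i"
  shows "u N \<le> u 0 + C / \<epsilon> + (\<Sum>i<N. e i)"
  using e step
proof (induction N)
  case 0
  then show ?case using C h by simp
next
  case (Suc n)
  let ?S = "\<Sum>i<n. e i"
  have S: "0 \<le> ?S" by (intro sum_nonneg) (simp add: Suc.prems(1))
  have IH: "u n \<le> u 0 + C / \<epsilon> + ?S" using Suc by simp
  have "u (Suc n) \<le> (1 - \<epsilon> * h) * u n + C * h + e n" using Suc by simp
  also have "\<dots> \<le> (1 - \<epsilon> * h) * (u 0 + C / \<epsilon> + ?S) + C * h + e n"
    using IH h by (intro add_right_mono mult_left_mono) simp_all
  also have "\<dots> = u 0 + C / \<epsilon> + ?S + e n - \<epsilon> * h * (u 0 + ?S)"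
    using h by (simp add: field_simps)
  also have "\<dots> \<le> u 0 + C / \<epsilon> + ?S + e n"
    using h u0 S by simp
  finally show ?case by simp
qed

lemma taylor2_upper_bound:
  fixes V V1 V2 V3 :: "real \<Rightarrow> real"
  assumes "\<And>x. x \<in> {l..u} \<Longrightarrow> (V has_real_derivative V1 x) (at x)"
    and "\<And>x. x \<in> {l..u} \<Longrightarrow> (V1 has_real_derivative V2 x) (at x)"
    and "\<And>x. x \<in> {l..u} \<Longrightarrow> (V2 has_real_derivative V3 x) (at x)"
    and B: "\<And>x. x \<in> {l..u} \<Longrightarrow> \<bar>V3 x\<bar> \<le> B"
    and x: "x \<in> {l..u}" and y: "y \<in> {l..u}"
  shows "V y \<le> V x + V1 x * (y - x) + V2 x * (y - x)\<^sup>2 / 2 + B * \<bar>y - x\<bar> ^ 3"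
proof (cases "y = x")
  case False
  define D where "D = (\<lambda>m::nat. if m = 0 then V else if m = 1 then V1 else if m = 2 then V2 else V3)"
  have "\<exists>z. (if y < x then y < z \<and> z < x else x < z \<and> z < y) \<and>
      V y = (\<Sum>m<3. (D m x / fact m) * (y - x) ^ m) + (D 3 z / fact 3) * (y - x) ^ 3"
  proof (rule Taylor[where a = l and b = u])
    show "\<forall>m t. m < 3 \<and> l \<le> t \<and> t \<le> u \<longrightarrow> (D m has_real_derivative D (Suc m) t) (at t)"
    proof (intro allI impI)
      fix m :: nat and t :: real
      assume *: "m < 3 \<and> l \<le> t \<and> t \<le> u"
      then consider "m = 0" | "m = 1" | "m = 2" by linarith
      then show "(D m has_real_derivative D (Suc m) t) (at t)"
        using * assms(1-3) by cases (simp_all add: D_def)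
    qed
  qed (use x y False in \<open>auto simp: D_def\<close>)
  then obtain z where "if y < x then y < z \<and> z < x else x < z \<and> z < y"
    and eq: "V y = (\<Sum>m<3. (D m x / fact m) * (y - x) ^ m) + (D 3 z / fact 3) * (y - x) ^ 3"
    by blast
  then have z: "z \<in> {l..u}"
    using x y by (auto split: if_splits)
  have "V3 z / 6 * (y - x) ^ 3 \<le> \<bar>V3 z\<bar> / 6 * \<bar>y - x\<bar> ^ 3"
    using abs_ge_self[of "V3 z / 6 * (y - x) ^ 3"] by (simp add: abs_mult power_abs)
  also have "\<dots> \<le> B * \<bar>y - x\<bar> ^ 3"
    using B[OF z] by (intro mult_right_mono) auto
  finally show ?thesis
    using eq by (simp add: D_def eval_nat_numeral field_simps)
qed simp

text \<open>Near \<open>z = 0\<close> the constant term wins, away from \<open>0\<close> the cubic term does. The constant \<open>K\<close>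
  depends only on the bounds \<open>v\<close> and \<open>D\<close>, so it serves all base points of a compact interval at once.\<close>

lemma cubic_majorant_pos:
  fixes D v :: real
  assumes "0 < v" "0 \<le> D"
  obtains K where "0 \<le> K"
    and "\<And>a b c z. v \<le> a \<Longrightarrow> \<bar>b\<bar> \<le> D \<Longrightarrow> \<bar>c\<bar> \<le> D \<Longrightarrow> v / 2 \<le> a + b * z + c * z\<^sup>2 / 2 + K * \<bar>z\<bar> ^ 3"
proof -
  \<comment> \<open>For \<open>\<bar>z\<bar> \<le> \<delta> \<le> 1\<close> the two middle terms cost at most \<open>3 D \<delta> / 2 \<le> v / 2\<close>; the summand \<open>1\<close> covers \<open>D = 0\<close>.\<close>
  define \<delta> where "\<delta> = min 1 (v / (3 * D + 1))"
  have \<delta>: "0 < \<delta>" "\<delta> \<le> 1" using assms by (auto simp: \<delta>_def)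
  have \<delta>D: "3 * D * \<delta> \<le> v"
  proof -
    have "3 * D * \<delta> \<le> (3 * D + 1) * (v / (3 * D + 1))"
      using assms \<delta> by (intro mult_mono) (auto simp: \<delta>_def)
    then show ?thesis using assms by simp
  qed
  define K where "K = 2 * D / \<delta>\<^sup>2"
  show ?thesis
  proof
    show "0 \<le> K" using assms by (simp add: K_def)
    fix a b c z :: real
    assume a: "v \<le> a" and b: "\<bar>b\<bar> \<le> D" and c: "\<bar>c\<bar> \<le> D"
    have bz: "- (D * \<bar>z\<bar>) \<le> b * z"
      using abs_ge_minus_self[of "b * z"] mult_right_mono[OF b abs_ge_zero[of z]]
      by (simp add: abs_mult)
    have cz: "- (D * z\<^sup>2) \<le> c * z\<^sup>2"
      using mult_right_mono[of "- D" c "z\<^sup>2"] c by simp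
    show "v / 2 \<le> a + b * z + c * z\<^sup>2 / 2 + K * \<bar>z\<bar> ^ 3"
    proof (cases "\<bar>z\<bar> \<le> \<delta>")
      case True
      have "z\<^sup>2 \<le> \<delta> * 1"
        using True \<delta> mult_mono[of "\<bar>z\<bar>" \<delta> "\<bar>z\<bar>" 1] by (simp add: power2_eq_square)
      then have "D * z\<^sup>2 \<le> D * \<delta>" using assms(2) by (simp add: mult_left_mono)
      moreover have "D * \<bar>z\<bar> \<le> D * \<delta>" using True assms(2) by (simp add: mult_left_mono)
      moreover have "0 \<le> K * \<bar>z\<bar> ^ 3" using assms by (simp add: K_def)
      ultimately show ?thesis using a bz cz \<delta>D assms(1) by linarith
    next
      case False
      then have 1: "1 \<le> \<bar>z\<bar> / \<delta>" using \<delta> by simp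
      have 2: "K * \<bar>z\<bar> ^ 3 = 2 * D * \<bar>z\<bar> * (\<bar>z\<bar> / \<delta>)\<^sup>2"
        by (simp add: K_def power2_eq_square power3_eq_cube)
      have 3: "K * \<bar>z\<bar> ^ 3 = 2 * D * z\<^sup>2 * (1 / \<delta>) * (\<bar>z\<bar> / \<delta>)"
        by (simp add: K_def power2_eq_square power3_eq_cube)
      have "2 * D * \<bar>z\<bar> * 1 \<le> 2 * D * \<bar>z\<bar> * (\<bar>z\<bar> / \<delta>)\<^sup>2"
        using 1 assms by (intro mult_left_mono one_le_power) auto
      moreover have "2 * D * z\<^sup>2 * 1 * 1 \<le> 2 * D * z\<^sup>2 * (1 / \<delta>) * (\<bar>z\<bar> / \<delta>)"
        using 1 assms \<delta> by (intro mult_mono) auto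
      ultimately have "D * \<bar>z\<bar> + D * z\<^sup>2 \<le> K * \<bar>z\<bar> ^ 3"
        using 2 3 by linarith
      moreover have "0 \<le> D * z\<^sup>2" using assms by simp
      ultimately show ?thesis using a bz cz assms(1) by linarith
    qed
  qed
qed

text \<open>Here \<open>d\<close> is the increment of a path over a step of length \<open>h\<close>, split into the drift integral \<open>I\<close> and the
  noise \<open>z\<close>, and \<open>G\<close> is the drift at the left end point. The error made by freezing
  the drift is kept as \<open>\<bar>I - h * G\<bar>\<close>: it is \<open>o(h)\<close> along each path, but not with a uniform rate. All other
  errors depend on \<open>z\<close> alone, which makes the right-hand side meaningful also when the path leaves the
  compact interval during the step.\<close>

lemma one_step_majorant:
  fixes V' a b c d I z h G \<Phi> D K :: real
  assumes taylor: "V' \<le> a + b * d + c * d\<^sup>2 / 2 + K * \<bar>d\<bar> ^ 3"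
    and d: "d = I + z" and I: "\<bar>I\<bar> \<le> h * \<Phi>" and b: "\<bar>b\<bar> \<le> D" and c: "\<bar>c\<bar> \<le> D" and K: "0 \<le> K"
  shows "V' \<le> a + b * (h * G + z) + c * z\<^sup>2 / 2 + D * \<bar>I - h * G\<bar>
      + D * (\<bar>z\<bar> * (h * \<Phi>) + (h * \<Phi>)\<^sup>2) + 4 * K * (\<bar>z\<bar> ^ 3 + (h * \<Phi>) ^ 3)"
proof -
  let ?f = "h * \<Phi>"
  have f0: "0 \<le> ?f" using I by linarith
  have D0: "0 \<le> D" using b by linarith
  have "b * d = b * (h * G + z) + b * (I - h * G)" by (simp add: d algebra_simps)
  also have "b * (I - h * G) \<le> D * \<bar>I - h * G\<bar>"
    using abs_ge_self[of "b * (I - h * G)"] mult_right_mono[OF b abs_ge_zero[of "I - h * G"]]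
    by (simp add: abs_mult)
  finally have 1: "b * d \<le> b * (h * G + z) + D * \<bar>I - h * G\<bar>" by simp
  have Iz: "\<bar>2 * I * z + I\<^sup>2\<bar> \<le> 2 * (\<bar>z\<bar> * ?f + ?f\<^sup>2)"
  proof -
    have "\<bar>2 * I * z + I\<^sup>2\<bar> \<le> 2 * (\<bar>z\<bar> * \<bar>I\<bar>) + \<bar>I\<bar>\<^sup>2"
      using abs_triangle_ineq[of "2 * I * z" "I\<^sup>2"] by (simp add: abs_mult mult_ac)
    also have "\<dots> \<le> 2 * (\<bar>z\<bar> * ?f) + ?f\<^sup>2"
      using I by (intro add_mono mult_left_mono power_mono) auto
    finally show ?thesis using zero_le_power2[of ?f] by (simp only: distrib_left)
  qed
  have "c * d\<^sup>2 / 2 = c * z\<^sup>2 / 2 + c * (2 * I * z + I\<^sup>2) / 2"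
    by (simp add: d power2_eq_square algebra_simps)
  also have "c * (2 * I * z + I\<^sup>2) \<le> D * \<bar>2 * I * z + I\<^sup>2\<bar>"
    using abs_ge_self[of "c * (2 * I * z + I\<^sup>2)"] mult_right_mono[OF c abs_ge_zero[of "2 * I * z + I\<^sup>2"]]
    unfolding abs_mult by linarith
  also have "\<dots> \<le> D * (2 * (\<bar>z\<bar> * ?f + ?f\<^sup>2))"
    using Iz D0 by (rule mult_left_mono)
  also have "D * (2 * (\<bar>z\<bar> * ?f + ?f\<^sup>2)) / 2 = D * (\<bar>z\<bar> * ?f + ?f\<^sup>2)" by simp
  finally have 2: "c * d\<^sup>2 / 2 \<le> c * z\<^sup>2 / 2 + D * (\<bar>z\<bar> * ?f + ?f\<^sup>2)" by simp
  have cube: "(x + y) ^ 3 \<le> 4 * (x ^ 3 + y ^ 3)" if "0 \<le> x" "0 \<le> y" for x y :: real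
  proof -
    have "4 * (x ^ 3 + y ^ 3) - (x + y) ^ 3 = 3 * ((x + y) * (x - y)\<^sup>2)"
      by (simp add: power2_eq_square power3_eq_cube algebra_simps)
    moreover have "0 \<le> (x + y) * (x - y)\<^sup>2" using that by simp
    ultimately show ?thesis by linarith
  qed
  have "\<bar>d\<bar> ^ 3 \<le> (\<bar>z\<bar> + ?f) ^ 3"
    using I d by (intro power_mono) auto
  also have "\<dots> \<le> 4 * (\<bar>z\<bar> ^ 3 + ?f ^ 3)" using f0 by (intro cube) auto
  finally have "K * \<bar>d\<bar> ^ 3 \<le> K * (4 * (\<bar>z\<bar> ^ 3 + ?f ^ 3))" using K by (rule mult_left_mono)
  then show ?thesis using taylor 1 2 by (simp add: algebra_simps)
qed

lemma left_riemann_defect_tendsto_0: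
  fixes k :: "real \<Rightarrow> real"
  assumes t: "0 < t" and k: "continuous_on {0..t} k"
  shows "(\<lambda>N. \<Sum>i<Suc N. \<bar>integral {real i * (t / Suc N)..real (Suc i) * (t / Suc N)} k
             - t / Suc N * k (real i * (t / Suc N))\<bar>) \<longlonglongrightarrow> 0"
proof (rule LIMSEQ_I)
  fix r :: real assume r: "0 < r"
  have uc: "uniformly_continuous_on {0..t} k"
    using k by (rule compact_uniformly_continuous) simp
  have "0 < r / (2 * t)" using r t by simp
  from uc[unfolded uniformly_continuous_on_def, rule_format, OF this]
  obtain \<delta> where \<delta>: "0 < \<delta>"
    "\<And>x y. x \<in> {0..t} \<Longrightarrow> y \<in> {0..t} \<Longrightarrow> dist y x < \<delta> \<Longrightarrow> dist (k y) (k x) < r / (2 * t)"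
    by auto
  obtain n :: nat where n: "t / \<delta> < real n" using reals_Archimedean2 by blast
  show "\<exists>no. \<forall>N\<ge>no. norm ((\<Sum>i<Suc N. \<bar>integral {real i * (t / Suc N)..real (Suc i) * (t / Suc N)} k
             - t / Suc N * k (real i * (t / Suc N))\<bar>) - 0) < r"
  proof (intro exI allI impI)
    fix N assume "n \<le> N"
    define h where "h = t / real (Suc N)"
    have "t / \<delta> < real (Suc N)" using n \<open>n \<le> N\<close> by linarith
    then have h: "0 < h" "h < \<delta>" using t \<delta>(1) by (auto simp: h_def field_simps)
    have Nh: "real (Suc N) * h = t" by (simp add: h_def)
    have term_le: "\<bar>integral {real i * h..real (Suc i) * h} k - h * k (real i * h)\<bar> \<le> r / (2 * t) * h"
      if i: "i < Suc N" for i
    proof -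
      let ?a = "real i * h" and ?b = "real (Suc i) * h"
      have b: "?b \<le> t" using i h Nh mult_right_mono[of "real (Suc i)" "real (Suc N)" h] by simp
      have a: "0 \<le> ?a" "?a \<le> ?b" "?b - ?a = h" using h by (simp_all add: algebra_simps)
      have int: "k integrable_on {?a..?b}"
        by (rule integrable_continuous_real, rule continuous_on_subset[OF k]) (use a b in auto)
      have "integral {?a..?b} k - h * k ?a = integral {?a..?b} (\<lambda>s. k s - k ?a)"
        using int a by (subst integral_diff) auto
      also have "norm \<dots> \<le> integral {?a..?b} (\<lambda>s. r / (2 * t))"
      proof (rule integral_norm_bound_integral)
        show "(\<lambda>s. k s - k ?a) integrable_on {?a..?b}" using int by (intro integrable_diff) auto
        fix s assume s: "s \<in> {?a..?b}"
        then have "dist s ?a < \<delta>" using a h by (auto simp: dist_real_def)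
        then show "norm (k s - k ?a) \<le> r / (2 * t)"
          using \<delta>(2)[of ?a s] s a(1) b by (simp add: dist_real_def)
      qed auto
      finally show ?thesis using a by (simp add: mult.commute)
    qed
    have "(\<Sum>i<Suc N. \<bar>integral {real i * h..real (Suc i) * h} k - h * k (real i * h)\<bar>)
        \<le> (\<Sum>i<Suc N. r / (2 * t) * h)"
      by (intro sum_mono term_le) simp
    also have "\<dots> = r / (2 * t) * (real (Suc N) * h)"
      by (simp only: sum_constant card_lessThan mult.left_commute)
    also have "\<dots> = r / (2 * t) * t" by (simp only: Nh)
    also have "\<dots> < r" using r t by simp
    finally have "norm ((\<Sum>i<Suc N. \<bar>integral {real i * h..real (Suc i) * h} k - h * k (real i * h)\<bar>) - 0) < r"
      by (simp only: diff_zero real_norm_def abs_of_nonneg[OF sum_nonneg] abs_ge_zero)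
    then show "norm ((\<Sum>i<Suc N. \<bar>integral {real i * (t / Suc N)..real (Suc i) * (t / Suc N)} k
             - t / Suc N * k (real i * (t / Suc N))\<bar>) - 0) < r"
      unfolding h_def .
  qed
qed

lemma closure_rationals_real: "closure (\<rat> :: real set) = UNIV"
proof (intro set_eqI iffI UNIV_I)
  fix x :: real
  show "x \<in> closure \<rat>"
    unfolding closure_approachable
  proof (intro allI impI)
    fix e :: real
    assume "0 < e"
    then obtain q where "q \<in> \<rat>" "x < q" "q < x + e"
      using Rats_dense_in_real[of x "x + e"] by auto
    then show "\<exists>q\<in>\<rat>. dist q x < e"
      by (intro bexI[of _ q]) (auto simp: dist_real_def)
  qed
qed

section \<open>Paths of a diffusion confined to a compact interval\<close>

text \<open>The functions \<open>V1\<close>, \<open>V2\<close>, \<open>V3\<close> are the derivatives of \<open>V\<close>, and \<open>lyapunov\<close> is the inequality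
  \<open>\<Gamma> V \<le> C - \<epsilon> V\<close> for the generator \<open>\<Gamma>\<close> of the equation with drift \<open>g\<close> and noise coefficient \<open>\<sigma>\<close>.\<close>

locale lyapunov_diffusion = brownian_motion M F W
  for M :: "'a measure" and F :: "real \<Rightarrow> 'a measure" and W :: "real \<Rightarrow> 'a \<Rightarrow> real" +
  fixes g :: "real \<Rightarrow> real" and \<sigma> y0 :: real and Y :: "real \<Rightarrow> 'a \<Rightarrow> real"
    and V V1 V2 V3 :: "real \<Rightarrow> real" and C \<epsilon> :: real
  assumes solution: "positive_global_solution M F W g \<sigma> y0 Y"
    and y0_pos: "0 < y0"
    and g_continuous: "continuous_on {0<..} g"
    and V_pos: "\<And>x. 0 < x \<Longrightarrow> 0 < V x"
    and V_deriv: "\<And>x. 0 < x \<Longrightarrow> (V has_real_derivative V1 x) (at x)"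
    and V1_deriv: "\<And>x. 0 < x \<Longrightarrow> (V1 has_real_derivative V2 x) (at x)"
    and V2_deriv: "\<And>x. 0 < x \<Longrightarrow> (V2 has_real_derivative V3 x) (at x)"
    and V3_continuous: "continuous_on {0<..} V3"
    and C_nonneg: "0 \<le> C" and \<epsilon>_pos: "0 < \<epsilon>"
    and lyapunov: "\<And>x. 0 < x \<Longrightarrow> V1 x * g x + \<sigma>\<^sup>2 / 2 * V2 x \<le> C - \<epsilon> * V x"
begin

definition regular_path :: "'a \<Rightarrow> bool" where
  "regular_path \<omega> \<longleftrightarrow> continuous_on {0..} (\<lambda>t. Y t \<omega>) \<and> Y 0 \<omega> = y0 \<and>
     (\<forall>t\<ge>0. Y t \<omega> > 0 \<and> set_integrable lborel {0..t} (\<lambda>s. g (Y s \<omega>)) \<and>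
       Y t \<omega> = y0 + (LBINT s:{0..t}. g (Y s \<omega>)) + \<sigma> * (W t \<omega> - W 0 \<omega>))"

lemma AE_regular_path: "AE \<omega> in M. regular_path \<omega>"
  using solution[unfolded positive_global_solution_def, THEN conjunct2]
  unfolding regular_path_def[abs_def] .

lemma Y_measurable_F: "0 \<le> t \<Longrightarrow> Y t \<in> borel_measurable (F t)"
  using solution[unfolded positive_global_solution_def, THEN conjunct1, rule_format] .

lemma Y_measurable: "0 \<le> t \<Longrightarrow> Y t \<in> borel_measurable M"
  by (rule borel_measurable_F_imp_M[OF _ Y_measurable_F])

lemma regular_path_continuous: "regular_path \<omega> \<Longrightarrow> 0 \<le> a \<Longrightarrow> continuous_on {a..b} (\<lambda>s. Y s \<omega>)"
  unfolding regular_path_def by (rule continuous_on_subset[of "{0..}"]) auto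

lemma regular_path_pos: "regular_path \<omega> \<Longrightarrow> 0 \<le> s \<Longrightarrow> 0 < Y s \<omega>"
  unfolding regular_path_def by blast

lemma regular_path_drift_continuous:
  assumes "regular_path \<omega>" "0 \<le> a"
  shows "continuous_on {a..b} (\<lambda>s. g (Y s \<omega>))"
  by (rule continuous_on_compose2[OF g_continuous regular_path_continuous[OF assms]])
    (use regular_path_pos[OF assms(1)] assms(2) in auto)

lemma regular_path_increment:
  assumes \<omega>: "regular_path \<omega>" and ab: "0 \<le> a" "a \<le> b"
  shows "Y b \<omega> - Y a \<omega> = integral {a..b} (\<lambda>s. g (Y s \<omega>)) + \<sigma> * (W b \<omega> - W a \<omega>)"
proof -
  have eq: "Y t \<omega> = y0 + integral {0..t} (\<lambda>s. g (Y s \<omega>)) + \<sigma> * (W t \<omega> - W 0 \<omega>)" if "0 \<le> t" for t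
    using \<omega> that by (simp add: regular_path_def set_borel_integral_eq_integral(2))
  have "(\<lambda>s. g (Y s \<omega>)) integrable_on {0..b}"
    by (rule integrable_continuous_real, rule regular_path_drift_continuous[OF \<omega>]) simp
  then have "integral {0..a} (\<lambda>s. g (Y s \<omega>)) + integral {a..b} (\<lambda>s. g (Y s \<omega>))
      = integral {0..b} (\<lambda>s. g (Y s \<omega>))"
    using ab by (intro Henstock_Kurzweil_Integration.integral_combine) auto
  moreover have "\<sigma> * (W b \<omega> - W a \<omega>) = \<sigma> * (W b \<omega> - W 0 \<omega>) - \<sigma> * (W a \<omega> - W 0 \<omega>)"
    by (simp add: algebra_simps)
  moreover note eq[OF ab(1)] eq[OF order_trans[OF ab]]
  ultimately show ?thesis by linarith
qed

text \<open>Only rational times are inspected, so that the event is a countable intersection and belongs to \<open>F t\<close>; on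
  regular paths continuity extends the bounds to all times in \<open>{0..t}\<close>. The time \<open>t\<close> itself is listed because it
  may be irrational.\<close>

definition confined :: "real \<Rightarrow> real \<Rightarrow> real \<Rightarrow> 'a set" where
  "confined l u t = {\<omega> \<in> space M. \<forall>s\<in>insert t (\<rat> \<inter> {0..t}). Y s \<omega> \<in> {l..u}}"

lemma confined_measurable_F:
  assumes t: "0 \<le> t"
  shows "confined l u t \<in> sets (F t)"
proof -
  have sp: "space (F t) = space M"
    using filtration_subalgebra[OF t] by (simp add: subalgebra_def)
  have [measurable]: "Y s \<in> borel_measurable (F t)" if "s \<in> insert t (\<rat> \<inter> {0..t})" for s
    using that t by (intro borel_measurable_F_mono[OF _ _ Y_measurable_F]) auto
  have "countable (insert t (\<rat> \<inter> {0..t}))"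
    by (simp add: countable_rat countable_Int1)
  moreover have "{\<omega> \<in> space (F t). Y s \<omega> \<in> {l..u}} \<in> sets (F t)"
    if "s \<in> insert t (\<rat> \<inter> {0..t})" for s
    using that by measurable
  ultimately have "(\<Inter>s\<in>insert t (\<rat> \<inter> {0..t}). {\<omega> \<in> space (F t). Y s \<omega> \<in> {l..u}}) \<in> sets (F t)"
    by (intro sets.countable_INT') (simp, simp, blast)
  also have "(\<Inter>s\<in>insert t (\<rat> \<inter> {0..t}). {\<omega> \<in> space (F t). Y s \<omega> \<in> {l..u}}) = confined l u t"
    unfolding confined_def sp by blast
  finally show ?thesis .
qed

lemma confined_measurable: "0 \<le> t \<Longrightarrow> confined l u t \<in> sets M"
  using confined_measurable_F[of t l u] filtration_subalgebra[of t] by (auto simp: subalgebra_def)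

lemma confined_path:
  assumes \<omega>: "regular_path \<omega>" "\<omega> \<in> confined l u t" and s: "0 \<le> s" "s \<le> t"
  shows "Y s \<omega> \<in> {l..u}"
proof (cases "s = t")
  case True
  then show ?thesis using \<omega> by (simp add: confined_def)
next
  case False
  then have t: "0 < t" using s False by simp
  let ?S = "{0..t} \<inter> (\<lambda>s. Y s \<omega>) -` {l..u}"
  have closed_S: "closed ?S"
    by (rule continuous_closed_preimage[OF regular_path_continuous[OF \<omega>(1)]]) simp_all
  have "{0<..<t} \<subseteq> closure (\<rat> :: real set)"
    unfolding closure_rationals_real by (rule subset_UNIV)
  then have "{0..t} = closure ({0<..<t} \<inter> \<rat>)"
    using closure_open_Int_superset[of "{0<..<t}" \<rat>] closure_greaterThanLessThan[OF t] by simp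
  also have "\<dots> \<subseteq> ?S"
    by (rule closure_minimal[OF _ closed_S]) (use \<omega> in \<open>auto simp: confined_def\<close>)
  finally show ?thesis using s by auto
qed

lemma confined_antimono_time:
  assumes "regular_path \<omega>" "\<omega> \<in> confined l u t" "0 \<le> s" "s \<le> t"
  shows "\<omega> \<in> confined l u s"
proof -
  have "\<omega> \<in> space M" using assms by (simp add: confined_def)
  then show ?thesis
    using confined_path[OF assms(1,2)] assms(3,4)
    unfolding confined_def by (intro CollectI conjI ballI) auto
qed

lemma V_continuous: "continuous_on {0<..} V"
  using V_deriv by (intro continuous_at_imp_continuous_on ballI DERIV_isCont) simp

lemma V1_continuous: "continuous_on {0<..} V1"
  using V1_deriv by (intro continuous_at_imp_continuous_on ballI DERIV_isCont) simp

lemma V2_continuous: "continuous_on {0<..} V2"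
  using V2_deriv by (intro continuous_at_imp_continuous_on ballI DERIV_isCont) simp

section \<open>The localised moment bound\<close>

text \<open>The expectation of those error terms of \<open>one_step_majorant\<close> that depend on \<open>z\<close> and \<open>h\<close> alone, for \<open>z = \<sigma> (W (s + h) - W s)\<close>. It is of order
  \<open>h powr (3 / 2)\<close>, so the errors of all \<open>t / h\<close> steps together are negligible.\<close>

definition one_step_error :: "real \<Rightarrow> real \<Rightarrow> real \<Rightarrow> real \<Rightarrow> real" where
  "one_step_error D K \<Phi> h =
     D * (\<bar>\<sigma>\<bar> * (sqrt (2 / pi) * sqrt h) * (h * \<Phi>) + (h * \<Phi>)\<^sup>2)
     + 4 * K * (\<bar>\<sigma>\<bar> ^ 3 * (2 * sqrt (2 / pi) * sqrt h ^ 3) + (h * \<Phi>) ^ 3)"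

lemma one_step_error_sublinear:
  assumes t: "0 < t"
  shows "(\<lambda>N. real (Suc N) * one_step_error D K \<Phi> (t / real (Suc N))) \<longlonglongrightarrow> 0"
proof -
  let ?e = "\<lambda>h. D * (\<bar>\<sigma>\<bar> * (sqrt (2 / pi) * sqrt h) * \<Phi> + h * \<Phi>\<^sup>2)
     + 4 * K * (\<bar>\<sigma>\<bar> ^ 3 * (2 * sqrt (2 / pi) * sqrt h) + h\<^sup>2 * \<Phi> ^ 3)"
  have eq: "real (Suc N) * one_step_error D K \<Phi> (t / real (Suc N)) = t * ?e (t / real (Suc N))" for N
  proof -
    define h where "h = t / real (Suc N)"
    have h: "0 < h" "real (Suc N) * h = t" using t by (simp_all add: h_def)
    have "sqrt h ^ 3 = h * sqrt h" using h(1) by (simp add: power3_eq_cube)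
    then have "one_step_error D K \<Phi> h = h * ?e h"
      unfolding one_step_error_def by (simp add: power2_eq_square power3_eq_cube algebra_simps)
    then show ?thesis using h(2) unfolding h_def[symmetric] by (metis mult.assoc)
  qed
  have lim: "(\<lambda>N. t / real (Suc N)) \<longlonglongrightarrow> 0"
    by (rule LIMSEQ_Suc[OF lim_const_over_n])
  have "(\<lambda>N. t * ?e (t / real (Suc N))) \<longlonglongrightarrow> t * ?e 0"
    by (intro tendsto_intros lim)
  then show ?thesis unfolding eq by simp
qed

context
  fixes l u :: real
  assumes l_pos: "0 < l" and l_le_u: "l \<le> u"
begin

text \<open>Composing with the projection onto \<open>{l..u}\<close> makes the coefficients bounded and continuous on the whole line
  without changing them on confined paths.\<close>

definition clamp :: "real \<Rightarrow> real" where
  "clamp x = max l (min u x)"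

lemma clamp_in: "clamp x \<in> {l..u}"
  using l_le_u by (auto simp: clamp_def)

lemma clamp_pos: "0 < clamp x"
  using l_pos by (simp add: clamp_def)

lemma clamp_id: "x \<in> {l..u} \<Longrightarrow> clamp x = x"
  by (auto simp: clamp_def)

lemma continuous_clamp:
  assumes "continuous_on {0<..} \<phi>"
  shows "continuous_on UNIV (\<lambda>x. \<phi> (clamp x) :: real)"
proof (rule continuous_on_compose2[OF assms])
  show "continuous_on UNIV clamp"
    unfolding clamp_def by (intro continuous_intros)
qed (use clamp_pos in auto)

lemma bounded_on_range:
  assumes "continuous_on {0<..} (\<phi> :: real \<Rightarrow> real)"
  obtains B where "0 \<le> B" "\<And>x. x \<in> {l..u} \<Longrightarrow> \<bar>\<phi> x\<bar> \<le> B"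
proof -
  have "continuous_on {l..u} \<phi>"
    by (rule continuous_on_subset[OF assms]) (use l_pos in auto)
  then have "compact (\<phi> ` {l..u})" by (rule compact_continuous_image) simp
  then have "bounded (\<phi> ` {l..u})" by (rule compact_imp_bounded)
  then obtain B where B: "\<And>x. x \<in> {l..u} \<Longrightarrow> \<bar>\<phi> x\<bar> \<le> B"
    unfolding bounded_iff real_norm_def by blast
  moreover have "0 \<le> B" using B[of l] l_le_u by simp
  ultimately show ?thesis using that by blast
qed

definition localized :: "(real \<Rightarrow> real) \<Rightarrow> real \<Rightarrow> 'a \<Rightarrow> real" where
  "localized \<phi> t \<omega> = indicator (confined l u t) \<omega> * \<phi> (clamp (Y t \<omega>))"

lemma localized_measurable_F:
  assumes \<phi>: "continuous_on {0<..} \<phi>" and t: "0 \<le> t"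
  shows "localized \<phi> t \<in> borel_measurable (F t)"
proof -
  have "(\<lambda>x. \<phi> (clamp x)) \<in> borel_measurable borel"
    using continuous_clamp[OF \<phi>] by (rule borel_measurable_continuous_onI)
  from measurable_compose[OF Y_measurable_F[OF t] this]
  show ?thesis
    unfolding localized_def[abs_def]
    by (intro borel_measurable_times borel_measurable_indicator confined_measurable_F[OF t])
qed

lemma localized_integrable:
  assumes \<phi>: "continuous_on {0<..} \<phi>" and t: "0 \<le> t"
  shows "integrable M (localized \<phi> t)"
proof -
  obtain B where B: "0 \<le> B" "\<And>x. x \<in> {l..u} \<Longrightarrow> \<bar>\<phi> x\<bar> \<le> B"
    using bounded_on_range[OF \<phi>] by blast
  have "norm (localized \<phi> t \<omega>) \<le> B" for \<omega>
    using B(1) B(2)[OF clamp_in] by (simp add: localized_def indicator_def)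
  then show ?thesis
    using borel_measurable_F_imp_M[OF t localized_measurable_F[OF \<phi> t]]
    by (intro integrable_const_bound[of _ B]) simp_all
qed

text \<open>On confined regular paths this is the error \<open>\<integral>\<^sub>a\<^sup>b g (Y s) ds - (b - a) g (Y a)\<close> of freezing the drift. Written
  through the values of \<open>Y\<close> and \<open>W\<close> at the two end points it is measurable as a function of \<open>\<omega>\<close>.\<close>

definition residual :: "real \<Rightarrow> real \<Rightarrow> 'a \<Rightarrow> real" where
  "residual a b \<omega> = Y b \<omega> - Y a \<omega> - \<sigma> * (W b \<omega> - W a \<omega>) - (b - a) * g (clamp (Y a \<omega>))"

lemma residual_measurable:
  assumes ab: "0 \<le> a" "0 \<le> b"
  shows "residual a b \<in> borel_measurable M"
proof -
  have "(\<lambda>x. g (clamp x)) \<in> borel_measurable borel"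
    using continuous_clamp[OF g_continuous] by (rule borel_measurable_continuous_onI)
  note 1 = measurable_compose[OF Y_measurable[OF ab(1)] this]
  note [measurable] = Y_measurable[OF ab(1)] Y_measurable[OF ab(2)] measurable_W[OF ab(1)]
    measurable_W[OF ab(2)] 1
  show ?thesis unfolding residual_def[abs_def] by measurable
qed

lemma residual_eq:
  assumes \<omega>: "regular_path \<omega>" "\<omega> \<in> confined l u b" and ab: "0 \<le> a" "a \<le> b"
  shows "residual a b \<omega> = integral {a..b} (\<lambda>s. g (Y s \<omega>)) - (b - a) * g (Y a \<omega>)"
  using regular_path_increment[OF \<omega>(1) ab] clamp_id[OF confined_path[OF \<omega> ab]]
  by (simp add: residual_def)

lemma drift_integral_bound:
  assumes \<omega>: "regular_path \<omega>" "\<omega> \<in> confined l u b" and ab: "0 \<le> a" "a \<le> b"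
    and \<Phi>: "\<And>x. x \<in> {l..u} \<Longrightarrow> \<bar>g x\<bar> \<le> \<Phi>"
  shows "\<bar>integral {a..b} (\<lambda>s. g (Y s \<omega>))\<bar> \<le> (b - a) * \<Phi>"
proof -
  have "norm (integral {a..b} (\<lambda>s. g (Y s \<omega>))) \<le> \<Phi> * (b - a)"
  proof (rule integral_bound[OF ab(2) regular_path_drift_continuous[OF \<omega>(1) ab(1)]])
    fix s assume "s \<in> {a..b}"
    then have "Y s \<omega> \<in> {l..u}" using ab by (intro confined_path[OF \<omega>]) auto
    then show "norm (g (Y s \<omega>)) \<le> \<Phi>" using \<Phi> by simp
  qed
  then show ?thesis by (simp add: mult.commute)
qed

lemma residual_bound:
  assumes \<omega>: "regular_path \<omega>" "\<omega> \<in> confined l u b" and ab: "0 \<le> a" "a \<le> b"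
    and \<Phi>: "\<And>x. x \<in> {l..u} \<Longrightarrow> \<bar>g x\<bar> \<le> \<Phi>"
  shows "\<bar>residual a b \<omega>\<bar> \<le> 2 * ((b - a) * \<Phi>)"
proof -
  have "\<bar>g (Y a \<omega>)\<bar> \<le> \<Phi>" using \<Phi> confined_path[OF \<omega> ab] by blast
  then have "\<bar>(b - a) * g (Y a \<omega>)\<bar> \<le> (b - a) * \<Phi>"
    using ab by (simp add: abs_mult mult_left_mono)
  then show ?thesis
    using drift_integral_bound[OF assms] residual_eq[OF \<omega> ab] by linarith
qed

lemma localized_residual_integrable:
  assumes ab: "0 \<le> a" "a \<le> b"
  shows "integrable M (\<lambda>\<omega>. indicator (confined l u b) \<omega> * \<bar>residual a b \<omega>\<bar>)"
proof -
  obtain \<Phi> where \<Phi>: "0 \<le> \<Phi>" "\<And>x. x \<in> {l..u} \<Longrightarrow> \<bar>g x\<bar> \<le> \<Phi>"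
    using bounded_on_range[OF g_continuous] by blast
  have b: "0 \<le> b" using ab by simp
  have "AE \<omega> in M. norm (indicator (confined l u b) \<omega> * \<bar>residual a b \<omega>\<bar>) \<le> 2 * ((b - a) * \<Phi>)"
    using AE_regular_path
  proof eventually_elim
    fix \<omega> assume "regular_path \<omega>"
    then show "norm (indicator (confined l u b) \<omega> * \<bar>residual a b \<omega>\<bar>) \<le> 2 * ((b - a) * \<Phi>)"
      using residual_bound[OF _ _ ab \<Phi>(2), of \<omega>] ab \<Phi>(1) by (cases "\<omega> \<in> confined l u b") simp_all
  qed
  then show ?thesis
    by (intro integrable_const_bound[of _ "2 * ((b - a) * \<Phi>)"] borel_measurable_times
      borel_measurable_indicator confined_measurable[OF b] borel_measurable_abs
      residual_measurable[OF ab(1) b])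
qed

text \<open>On the event that the path is confined up to \<open>b\<close>, the Taylor majorant \<open>P\<close> bounds \<open>V (Y b)\<close>. On the rest of
  the event that it is confined up to \<open>a\<close>, the left-hand side vanishes and \<open>P\<close> is nonnegative by \<open>majorant\<close>
  and \<open>small\<close>. So \<open>P\<close> can be integrated against the indicator of the latter event, which belongs to \<open>F a\<close> and is
  therefore independent of the increment. The expectation of \<open>P\<close> contains the generator
  applied to \<open>V\<close>, and the Lyapunov inequality applies.\<close>

lemma localized_step:
  assumes ab: "0 \<le> a" "a < b" and v: "0 < v" and D: "0 \<le> D" and K: "0 \<le> K" and \<Phi>0: "0 \<le> \<Phi>"
    and \<Phi>: "\<And>x. x \<in> {l..u} \<Longrightarrow> \<bar>g x\<bar> \<le> \<Phi>"
    and D1: "\<And>x. x \<in> {l..u} \<Longrightarrow> \<bar>V1 x\<bar> \<le> D" and D2: "\<And>x. x \<in> {l..u} \<Longrightarrow> \<bar>V2 x\<bar> \<le> D"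
    and K3: "\<And>x. x \<in> {l..u} \<Longrightarrow> \<bar>V3 x\<bar> \<le> K"
    and majorant: "\<And>x z. x \<in> {l..u} \<Longrightarrow> v / 2 \<le> V x + V1 x * z + V2 x * z\<^sup>2 / 2 + K * \<bar>z\<bar> ^ 3"
    and small: "(b - a) * (D * \<Phi>) \<le> v / 2"
  shows "expectation (localized V b) \<le> (1 - \<epsilon> * (b - a)) * expectation (localized V a) + C * (b - a)
      + (D * expectation (\<lambda>\<omega>. indicator (confined l u b) \<omega> * \<bar>residual a b \<omega>\<bar>)
         + one_step_error D K \<Phi> (b - a))"
proof -
  define h where "h = b - a"
  have h: "0 < h" "0 \<le> h" using ab by (simp_all add: h_def)
  have ab': "a \<le> b" "0 \<le> b" using ab by simp_all
  define \<xi> where "\<xi> = (\<lambda>\<omega>. W b \<omega> - W a \<omega>)"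
  define \<phi>0 where "\<phi>0 = (\<lambda>x. V x + h * (V1 x * g x))"
  define \<phi>1 where "\<phi>1 = (\<lambda>x. \<sigma> * V1 x)"
  define \<phi>2 where "\<phi>2 = (\<lambda>x. \<sigma>\<^sup>2 / 2 * V2 x)"
  have c0: "continuous_on {0<..} \<phi>0" unfolding \<phi>0_def
    by (intro continuous_intros V_continuous V1_continuous g_continuous)
  have c1: "continuous_on {0<..} \<phi>1" unfolding \<phi>1_def
    by (intro continuous_intros V1_continuous)
  have c2: "continuous_on {0<..} \<phi>2" unfolding \<phi>2_def
    by (intro continuous_intros V2_continuous)
  have \<xi>_eq: "W b \<omega> - W a \<omega> = \<xi> \<omega>" for \<omega> by (simp add: \<xi>_def)
  note moments = increment_moments[OF ab, folded h_def, unfolded \<xi>_eq]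
  define e where "e = (\<lambda>\<omega>. D * (\<bar>\<sigma>\<bar> * \<bar>\<xi> \<omega>\<bar> * (h * \<Phi>) + (h * \<Phi>)\<^sup>2)
      + 4 * K * (\<bar>\<sigma>\<bar> ^ 3 * \<bar>\<xi> \<omega>\<bar> ^ 3 + (h * \<Phi>) ^ 3))"
  define r where "r = (\<lambda>\<omega>. indicator (confined l u b) \<omega> * \<bar>residual a b \<omega>\<bar>)"
  define P where "P = (\<lambda>\<omega>. localized \<phi>0 a \<omega> + localized \<phi>1 a \<omega> * \<xi> \<omega> + localized \<phi>2 a \<omega> * (\<xi> \<omega>)\<^sup>2
      + e \<omega> + D * r \<omega>)"
  have i0: "has_bochner_integral M (localized \<phi>0 a) (expectation (localized \<phi>0 a))"
    using localized_integrable[OF c0 ab(1)] by (rule has_bochner_integral_integrable)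
  have i1: "has_bochner_integral M (\<lambda>\<omega>. localized \<phi>1 a \<omega> * \<xi> \<omega>) (expectation (localized \<phi>1 a) * 0)"
    unfolding \<xi>_def
    by (rule has_bochner_integral_times_increment[OF ab localized_measurable_F[OF c1 ab(1)]
          localized_integrable[OF c1 ab(1)] _ moments(1)[unfolded \<xi>_def]]) simp
  have i2: "has_bochner_integral M (\<lambda>\<omega>. localized \<phi>2 a \<omega> * (\<xi> \<omega>)\<^sup>2) (expectation (localized \<phi>2 a) * h)"
    unfolding \<xi>_def
    by (rule has_bochner_integral_times_increment[OF ab localized_measurable_F[OF c2 ab(1)]
          localized_integrable[OF c2 ab(1)] _ moments(2)[unfolded \<xi>_def]]) simp
  have const: "has_bochner_integral M (\<lambda>\<omega>. k) k" for k :: real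
    using has_bochner_integral_integrable[of M "\<lambda>\<omega>. k"] by (simp add: prob_space)
  have ie: "has_bochner_integral M e (one_step_error D K \<Phi> h)"
    unfolding e_def one_step_error_def
    by (intro has_bochner_integral_add has_bochner_integral_mult_right has_bochner_integral_mult_left
        moments const)
  have ir: "has_bochner_integral M (\<lambda>\<omega>. D * r \<omega>) (D * expectation r)"
    unfolding r_def
    by (intro has_bochner_integral_mult_right has_bochner_integral_integrable
        localized_residual_integrable ab(1) ab'(1))
  have iP: "has_bochner_integral M P (expectation (localized \<phi>0 a) + expectation (localized \<phi>1 a) * 0
      + expectation (localized \<phi>2 a) * h + one_step_error D K \<Phi> h + D * expectation r)"
    unfolding P_def by (intro has_bochner_integral_add i0 i1 i2 ie ir)
  have e0: "0 \<le> e \<omega>" for \<omega>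
    unfolding e_def using D K \<Phi>0 h by (intro add_nonneg_nonneg mult_nonneg_nonneg) auto
  have "AE \<omega> in M. localized V b \<omega> \<le> P \<omega>"
    using AE_regular_path
  proof eventually_elim
    fix \<omega> assume \<omega>: "regular_path \<omega>"
    define y where "y = Y a \<omega>"
    define z where "z = \<sigma> * \<xi> \<omega>"
    have P_inside: "P \<omega> = V y + V1 y * (h * g y + z) + V2 y * z\<^sup>2 / 2
        + D * (\<bar>z\<bar> * (h * \<Phi>) + (h * \<Phi>)\<^sup>2) + 4 * K * (\<bar>z\<bar> ^ 3 + (h * \<Phi>) ^ 3) + D * r \<omega>"
      if "\<omega> \<in> confined l u a" "y \<in> {l..u}"
      using that clamp_id[OF that(2)]
      by (simp add: P_def localized_def e_def \<phi>0_def \<phi>1_def \<phi>2_def z_def y_def abs_mult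
          power_mult_distrib algebra_simps)
    show "localized V b \<omega> \<le> P \<omega>"
    proof (cases "\<omega> \<in> confined l u b")
      case True
      have a_conf: "\<omega> \<in> confined l u a"
        by (rule confined_antimono_time[OF \<omega> True ab(1) ab'(1)])
      have ya: "y \<in> {l..u}" unfolding y_def by (rule confined_path[OF \<omega> True ab(1) ab'(1)])
      have yb: "Y b \<omega> \<in> {l..u}" by (rule confined_path[OF \<omega> True ab'(2) order_refl])
      define I where "I = integral {a..b} (\<lambda>s. g (Y s \<omega>))"
      have res: "r \<omega> = \<bar>I - h * g y\<bar>"
        using residual_eq[OF \<omega> True ab(1) ab'(1)] True by (simp add: r_def I_def h_def y_def)
      have lb: "localized V b \<omega> = V (Y b \<omega>)"
        using True clamp_id[OF yb] by (simp add: localized_def)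
      have "V (Y b \<omega>) \<le> V y + V1 y * (h * g y + z) + V2 y * z\<^sup>2 / 2 + D * \<bar>I - h * g y\<bar>
          + D * (\<bar>z\<bar> * (h * \<Phi>) + (h * \<Phi>)\<^sup>2) + 4 * K * (\<bar>z\<bar> ^ 3 + (h * \<Phi>) ^ 3)"
      proof (rule one_step_majorant)
        have pos: "0 < x" if "x \<in> {l..u}" for x using that l_pos by simp
        show "V (Y b \<omega>) \<le> V y + V1 y * (Y b \<omega> - y) + V2 y * (Y b \<omega> - y)\<^sup>2 / 2
            + K * \<bar>Y b \<omega> - y\<bar> ^ 3"
          by (rule taylor2_upper_bound[OF V_deriv[OF pos] V1_deriv[OF pos] V2_deriv[OF pos] K3 ya yb])
        show "Y b \<omega> - y = I + z"
          using regular_path_increment[OF \<omega> ab(1) ab'(1)] by (simp add: I_def z_def y_def \<xi>_def)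
        show "\<bar>I\<bar> \<le> h * \<Phi>"
          unfolding I_def h_def by (rule drift_integral_bound[OF \<omega> True ab(1) ab'(1) \<Phi>])
      qed (rule D1[OF ya] D2[OF ya] K)+
      then show ?thesis using P_inside[OF a_conf ya, unfolded res] lb by linarith
    next
      case False
      then have "localized V b \<omega> = 0" "r \<omega> = 0" by (simp_all add: localized_def r_def)
      moreover have "0 \<le> P \<omega>"
      proof (cases "\<omega> \<in> confined l u a")
        case True
        have ya: "y \<in> {l..u}" unfolding y_def by (rule confined_path[OF \<omega> True ab(1) order_refl])
        have "\<bar>V1 y * g y\<bar> \<le> D * \<Phi>"
          unfolding abs_mult using D1[OF ya] \<Phi>[OF ya] by (intro mult_mono) auto
        from mult_left_mono[OF this h(2)] have "h * \<bar>V1 y * g y\<bar> \<le> v / 2"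
          using small unfolding h_def[symmetric] by linarith
        moreover have "- (h * \<bar>V1 y * g y\<bar>) \<le> h * (V1 y * g y)"
          using h mult_left_mono[OF abs_ge_minus_self[of "V1 y * g y"] h(2)] by simp
        moreover have "0 \<le> D * (\<bar>z\<bar> * (h * \<Phi>) + (h * \<Phi>)\<^sup>2)" "0 \<le> K * \<bar>z\<bar> ^ 3" "0 \<le> K * (h * \<Phi>) ^ 3"
          using D K \<Phi>0 h by (intro mult_nonneg_nonneg add_nonneg_nonneg; simp)+
        moreover have "P \<omega> = V y + V1 y * z + V2 y * z\<^sup>2 / 2 + h * (V1 y * g y)
            + D * (\<bar>z\<bar> * (h * \<Phi>) + (h * \<Phi>)\<^sup>2) + 4 * (K * \<bar>z\<bar> ^ 3) + 4 * (K * (h * \<Phi>) ^ 3)"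
          using P_inside[OF True ya] \<open>r \<omega> = 0\<close> by (simp add: algebra_simps)
        ultimately show ?thesis using majorant[OF ya, of z] by linarith
      next
        case False
        then have "P \<omega> = e \<omega>" using \<open>r \<omega> = 0\<close> by (simp add: P_def localized_def)
        then show ?thesis using e0 by simp
      qed
      ultimately show ?thesis by simp
    qed
  qed
  then have "expectation (localized V b) \<le> expectation P"
    using localized_integrable[OF V_continuous ab'(2)] iP
    by (intro integral_mono_AE) (auto simp: has_bochner_integral_iff)
  also have "expectation P = expectation (localized \<phi>0 a) + h * expectation (localized \<phi>2 a)
      + (D * expectation r + one_step_error D K \<Phi> h)"
    using iP by (simp add: has_bochner_integral_iff)
  also have "expectation (localized \<phi>0 a) + h * expectation (localized \<phi>2 a)
      = expectation (\<lambda>\<omega>. localized \<phi>0 a \<omega> + h * localized \<phi>2 a \<omega>)"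
    using localized_integrable[OF c0 ab(1)] localized_integrable[OF c2 ab(1)] by simp
  also have "\<dots> \<le> expectation (\<lambda>\<omega>. (1 - \<epsilon> * h) * localized V a \<omega> + C * h)"
  proof (rule integral_mono)
    fix \<omega>
    define y where "y = clamp (Y a \<omega>)"
    have "h * (V1 y * g y + \<sigma>\<^sup>2 / 2 * V2 y) \<le> h * (C - \<epsilon> * V y)"
      using lyapunov[of y] clamp_pos h(2) by (intro mult_left_mono) (simp_all add: y_def)
    moreover have "0 \<le> C * h" using C_nonneg h(2) by simp
    ultimately show "localized \<phi>0 a \<omega> + h * localized \<phi>2 a \<omega> \<le> (1 - \<epsilon> * h) * localized V a \<omega> + C * h"
      unfolding localized_def y_def[symmetric]
      by (cases "\<omega> \<in> confined l u a") (simp_all add: \<phi>0_def \<phi>2_def algebra_simps)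
  qed (use localized_integrable[OF c0 ab(1)] localized_integrable[OF c2 ab(1)]
      localized_integrable[OF V_continuous ab(1)] in simp_all)
  also have "\<dots> = (1 - \<epsilon> * h) * expectation (localized V a) + C * h"
    using localized_integrable[OF V_continuous ab(1)] by (simp add: prob_space)
  finally show ?thesis unfolding r_def h_def by simp
qed

text \<open>Along each path this is the convergence of left Riemann sums of a continuous function; the sums are at most
  \<open>2 t \<Phi>\<close> if \<open>\<bar>g\<bar> \<le> \<Phi>\<close> on \<open>{l..u}\<close>, so dominated convergence applies.\<close>

lemma localized_residual_sum_tendsto_0:
  assumes t: "0 < t"
  defines "h \<equiv> \<lambda>N. t / real (Suc N)"
  shows "(\<lambda>N. \<Sum>i<Suc N. expectation (\<lambda>\<omega>. indicator (confined l u (real (Suc i) * h N)) \<omega>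
      * \<bar>residual (real i * h N) (real (Suc i) * h N) \<omega>\<bar>)) \<longlonglongrightarrow> 0"
proof -
  define r where "r = (\<lambda>N i \<omega>. indicator (confined l u (real (Suc i) * h N)) \<omega>
      * \<bar>residual (real i * h N) (real (Suc i) * h N) \<omega>\<bar>)"
  have h: "0 < h N" "real (Suc N) * h N = t" for N using t by (simp_all add: h_def)
  have grid: "0 \<le> real i * h N" "real i * h N \<le> real (Suc i) * h N"
    "real (Suc i) * h N - real i * h N = h N" for i N
    using h(1)[of N] by (simp_all add: algebra_simps)
  have r0: "0 \<le> r N i \<omega>" for N i \<omega> by (simp add: r_def)
  have r_int: "integrable M (r N i)" for N i
    unfolding r_def by (rule localized_residual_integrable[OF grid(1,2)])
  obtain \<Phi> where \<Phi>: "0 \<le> \<Phi>" "\<And>x. x \<in> {l..u} \<Longrightarrow> \<bar>g x\<bar> \<le> \<Phi>"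
    using bounded_on_range[OF g_continuous] by blast
  have "(\<lambda>N. expectation (\<lambda>\<omega>. \<Sum>i<Suc N. r N i \<omega>)) \<longlonglongrightarrow> expectation (\<lambda>\<omega>. 0)"
  proof (rule integral_dominated_convergence)
    show "(\<lambda>\<omega>. \<Sum>i<Suc N. r N i \<omega>) \<in> borel_measurable M" for N
      by (intro borel_measurable_sum borel_measurable_integrable r_int)
    show "integrable M (\<lambda>\<omega>. 2 * (t * \<Phi>))" by simp
    show "AE \<omega> in M. norm (\<Sum>i<Suc N. r N i \<omega>) \<le> 2 * (t * \<Phi>)" for N
      using AE_regular_path
    proof eventually_elim
      fix \<omega> assume \<omega>: "regular_path \<omega>"
      have "r N i \<omega> \<le> 2 * (h N * \<Phi>)" for i
        using residual_bound[OF \<omega> _ grid(1,2) \<Phi>(2), of i N] grid(3)[of i N] \<Phi>(1) h(1)[of N]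
        unfolding r_def by (cases "\<omega> \<in> confined l u (real (Suc i) * h N)") simp_all
      then have "(\<Sum>i<Suc N. r N i \<omega>) \<le> (\<Sum>i<Suc N. 2 * (h N * \<Phi>))" by (intro sum_mono)
      also have "\<dots> = 2 * ((real (Suc N) * h N) * \<Phi>)"
        by (simp only: sum_constant card_lessThan mult_ac)
      finally have "(\<Sum>i<Suc N. r N i \<omega>) \<le> 2 * (t * \<Phi>)" by (simp only: h(2))
      moreover have "0 \<le> (\<Sum>i<Suc N. r N i \<omega>)" by (intro sum_nonneg r0)
      ultimately show "norm (\<Sum>i<Suc N. r N i \<omega>) \<le> 2 * (t * \<Phi>)"
        by (simp only: real_norm_def abs_of_nonneg)
    qed
    show "AE \<omega> in M. (\<lambda>N. \<Sum>i<Suc N. r N i \<omega>) \<longlonglongrightarrow> 0"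
      using AE_regular_path
    proof eventually_elim
      fix \<omega> assume \<omega>: "regular_path \<omega>"
      let ?d = "\<lambda>N i. \<bar>integral {real i * h N..real (Suc i) * h N} (\<lambda>s. g (Y s \<omega>))
          - h N * g (Y (real i * h N) \<omega>)\<bar>"
      have lim: "(\<lambda>N. \<Sum>i<Suc N. ?d N i) \<longlonglongrightarrow> 0"
        unfolding h_def
        by (rule left_riemann_defect_tendsto_0[OF t regular_path_drift_continuous[OF \<omega> order_refl]])
      have le: "r N i \<omega> \<le> ?d N i" for N i
        using residual_eq[OF \<omega> _ grid(1,2), of i N] grid(3)[of i N]
        unfolding r_def by (cases "\<omega> \<in> confined l u (real (Suc i) * h N)") simp_all
      show "(\<lambda>N. \<Sum>i<Suc N. r N i \<omega>) \<longlonglongrightarrow> 0"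
      proof (rule tendsto_sandwich[OF _ _ tendsto_const lim])
        show "\<forall>\<^sub>F N in sequentially. 0 \<le> (\<Sum>i<Suc N. r N i \<omega>)"
          by (intro always_eventually allI sum_nonneg r0)
        show "\<forall>\<^sub>F N in sequentially. (\<Sum>i<Suc N. r N i \<omega>) \<le> (\<Sum>i<Suc N. ?d N i)"
          by (intro always_eventually allI sum_mono le)
      qed
    qed
  qed simp
  also have "(\<lambda>N. expectation (\<lambda>\<omega>. \<Sum>i<Suc N. r N i \<omega>)) = (\<lambda>N. \<Sum>i<Suc N. expectation (r N i))"
    by (intro ext Bochner_Integration.integral_sum r_int)
  finally show ?thesis unfolding r_def by simp
qed

lemma localized_lyapunov_bound:
  assumes t: "0 \<le> t"
  shows "expectation (localized V t) \<le> V y0 + C / \<epsilon>"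
proof -
  have V0: "expectation (localized V 0) \<le> V y0"
  proof -
    have "AE \<omega> in M. localized V 0 \<omega> \<le> V y0"
      using AE_regular_path
    proof eventually_elim
      fix \<omega> assume \<omega>: "regular_path \<omega>"
      show "localized V 0 \<omega> \<le> V y0"
      proof (cases "\<omega> \<in> confined l u 0")
        case True
        have "Y 0 \<omega> = y0" using \<omega> by (simp only: regular_path_def)
        moreover have "Y 0 \<omega> \<in> {l..u}" by (rule confined_path[OF \<omega> True order_refl order_refl])
        ultimately show ?thesis using True clamp_id[of y0] by (simp add: localized_def)
      qed (use V_pos[OF y0_pos] in \<open>simp add: localized_def\<close>)
    qed
    then have "expectation (localized V 0) \<le> expectation (\<lambda>\<omega>. V y0)"
      using localized_integrable[OF V_continuous order_refl] by (intro integral_mono_AE) simp_all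
    then show ?thesis by (simp add: prob_space)
  qed
  have C\<epsilon>: "0 \<le> C / \<epsilon>" using C_nonneg \<epsilon>_pos by simp
  show ?thesis
  proof (cases "t = 0")
    case True
    then show ?thesis using V0 C\<epsilon> by simp
  next
    case False
    then have tp: "0 < t" using t by simp
    obtain \<Phi> where \<Phi>: "0 \<le> \<Phi>" "\<And>x. x \<in> {l..u} \<Longrightarrow> \<bar>g x\<bar> \<le> \<Phi>"
      using bounded_on_range[OF g_continuous] by blast
    obtain B1 where B1: "0 \<le> B1" "\<And>x. x \<in> {l..u} \<Longrightarrow> \<bar>V1 x\<bar> \<le> B1"
      using bounded_on_range[OF V1_continuous] by blast
    obtain B2 where B2: "0 \<le> B2" "\<And>x. x \<in> {l..u} \<Longrightarrow> \<bar>V2 x\<bar> \<le> B2"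
      using bounded_on_range[OF V2_continuous] by blast
    obtain B3 where B3: "0 \<le> B3" "\<And>x. x \<in> {l..u} \<Longrightarrow> \<bar>V3 x\<bar> \<le> B3"
      using bounded_on_range[OF V3_continuous] by blast
    have "continuous_on {l..u} V"
      by (rule continuous_on_subset[OF V_continuous]) (use l_pos in auto)
    from continuous_attains_inf[OF compact_Icc _ this] l_le_u
    obtain m where m: "m \<in> {l..u}" "\<And>x. x \<in> {l..u} \<Longrightarrow> V m \<le> V x" by auto
    define v where "v = V m"
    have v: "0 < v" "\<And>x. x \<in> {l..u} \<Longrightarrow> v \<le> V x"
      using V_pos[of m] m l_pos by (auto simp: v_def)
    define D where "D = max B1 B2"
    have D: "0 \<le> D" "\<And>x. x \<in> {l..u} \<Longrightarrow> \<bar>V1 x\<bar> \<le> D" "\<And>x. x \<in> {l..u} \<Longrightarrow> \<bar>V2 x\<bar> \<le> D"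
      using B1 B2 by (auto simp: D_def le_max_iff_disj)
    obtain K0 where K0: "0 \<le> K0" "\<And>a b c z. v \<le> a \<Longrightarrow> \<bar>b\<bar> \<le> D \<Longrightarrow> \<bar>c\<bar> \<le> D
        \<Longrightarrow> v / 2 \<le> a + b * z + c * z\<^sup>2 / 2 + K0 * \<bar>z\<bar> ^ 3"
      using cubic_majorant_pos[OF v(1) D(1)] by blast
    \<comment> \<open>\<open>K\<close> has to bound the Taylor remainder and to make the majorant positive.\<close>
    define K where "K = max K0 B3"
    have K: "0 \<le> K" "\<And>x. x \<in> {l..u} \<Longrightarrow> \<bar>V3 x\<bar> \<le> K"
      using K0(1) B3 by (auto simp: K_def le_max_iff_disj)
    have majorant: "v / 2 \<le> V x + V1 x * z + V2 x * z\<^sup>2 / 2 + K * \<bar>z\<bar> ^ 3" if x: "x \<in> {l..u}" for x z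
    proof -
      have "K0 * \<bar>z\<bar> ^ 3 \<le> K * \<bar>z\<bar> ^ 3" by (intro mult_right_mono) (simp_all add: K_def)
      then show ?thesis using K0(2)[OF v(2)[OF x] D(2)[OF x] D(3)[OF x], of z] by linarith
    qed
    define h where "h = (\<lambda>N. t / real (Suc N))"
    define R where "R = (\<lambda>N i. expectation (\<lambda>\<omega>. indicator (confined l u (real (Suc i) * h N)) \<omega>
        * \<bar>residual (real i * h N) (real (Suc i) * h N) \<omega>\<bar>))"
    have h: "0 < h N" "real (Suc N) * h N = t" for N using tp by (simp_all add: h_def)
    have grid: "0 \<le> real i * h N" "real i * h N < real (Suc i) * h N"
      "real (Suc i) * h N - real i * h N = h N" for i N
      using h(1)[of N] by (simp_all add: algebra_simps)
    have h_lim: "h \<longlonglongrightarrow> 0" unfolding h_def by (rule LIMSEQ_Suc[OF lim_const_over_n])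
    have "(\<lambda>N. h N * (D * \<Phi>)) \<longlonglongrightarrow> 0" "(\<lambda>N. \<epsilon> * h N) \<longlonglongrightarrow> 0"
      using tendsto_mult_right[OF h_lim, of "D * \<Phi>"] tendsto_mult_left[OF h_lim, of \<epsilon>] by simp_all
    from order_tendstoD(2)[OF this(1), of "v / 2"] order_tendstoD(2)[OF this(2), of 1]
    have small: "\<forall>\<^sub>F N in sequentially. h N * (D * \<Phi>) < v / 2" "\<forall>\<^sub>F N in sequentially. \<epsilon> * h N < 1"
      using v(1) by simp_all
    have "\<forall>\<^sub>F N in sequentially. expectation (localized V t) \<le> V y0 + C / \<epsilon>
        + (D * (\<Sum>i<Suc N. R N i) + real (Suc N) * one_step_error D K \<Phi> (h N))"
      using small
    proof eventually_elim
      fix N assume N: "h N * (D * \<Phi>) < v / 2" "\<epsilon> * h N < 1"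
      let ?u = "\<lambda>i. expectation (localized V (real i * h N))"
      let ?e = "\<lambda>i. D * R N i + one_step_error D K \<Phi> (h N)"
      have "?u (Suc N) \<le> ?u 0 + C / \<epsilon> + (\<Sum>i<Suc N. ?e i)"
      proof (rule discrete_gronwall[where h = "h N"])
        show "0 \<le> ?u 0"
          unfolding localized_def
          by (intro integral_nonneg_AE AE_I2 mult_nonneg_nonneg less_imp_le[OF V_pos[OF clamp_pos]]) simp
        fix i
        show "0 \<le> ?e i"
          unfolding R_def one_step_error_def using D(1) K(1) \<Phi>(1) h(1)[of N]
          by (intro add_nonneg_nonneg mult_nonneg_nonneg integral_nonneg_AE AE_I2; simp)
        show "?u (Suc i) \<le> (1 - \<epsilon> * h N) * ?u i + C * h N + ?e i"
          using localized_step[OF grid(1)[of i N] grid(2)[of i N] v(1) D(1) K(1) \<Phi>(1) \<Phi>(2) D(2) D(3)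
              K(2) majorant] N(1)
          unfolding grid(3) R_def by simp
      qed (use h(1)[of N] N(2) \<epsilon>_pos C_nonneg in simp_all)
      also have "(\<Sum>i<Suc N. ?e i) = D * (\<Sum>i<Suc N. R N i) + real (Suc N) * one_step_error D K \<Phi> (h N)"
        by (simp only: sum.distrib sum_distrib_left sum_constant card_lessThan)
      finally have "?u (Suc N) \<le> ?u 0 + C / \<epsilon>
          + (D * (\<Sum>i<Suc N. R N i) + real (Suc N) * one_step_error D K \<Phi> (h N))" .
      moreover have "?u 0 \<le> V y0" using V0 by simp
      moreover have "?u (Suc N) = expectation (localized V t)" by (simp only: h(2))
      ultimately show "expectation (localized V t) \<le> V y0 + C / \<epsilon>
          + (D * (\<Sum>i<Suc N. R N i) + real (Suc N) * one_step_error D K \<Phi> (h N))" by linarith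
    qed
    moreover have "(\<lambda>N. V y0 + C / \<epsilon>
        + (D * (\<Sum>i<Suc N. R N i) + real (Suc N) * one_step_error D K \<Phi> (h N)))
        \<longlonglongrightarrow> V y0 + C / \<epsilon> + (D * 0 + 0)"
      unfolding R_def h_def
      by (intro tendsto_intros localized_residual_sum_tendsto_0 one_step_error_sublinear tp)
    ultimately have "expectation (localized V t) \<le> V y0 + C / \<epsilon> + (D * 0 + 0)"
      by (intro tendsto_lowerbound[OF _ _ sequentially_bot])
    then show ?thesis by simp
  qed
qed

end

section \<open>Removing the localisation\<close>

text \<open>On \<open>{0..t}\<close> a positive continuous path is bounded, and bounded away from \<open>0\<close>.\<close>

lemma eventually_localized_eq:
  assumes \<omega>: "regular_path \<omega>" "\<omega> \<in> space M" and t: "0 \<le> t"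
  shows "\<forall>\<^sub>F n in sequentially. localized (1 / real (Suc n)) (real (Suc n)) \<phi> t \<omega> = \<phi> (Y t \<omega>)"
proof -
  have cont: "continuous_on {0..t} (\<lambda>s. Y s \<omega>)"
    by (rule regular_path_continuous[OF \<omega>(1) order_refl])
  have ne: "{0..t} \<noteq> {}" using t by simp
  obtain s1 where s1: "s1 \<in> {0..t}" "\<And>s. s \<in> {0..t} \<Longrightarrow> Y s1 \<omega> \<le> Y s \<omega>"
    using continuous_attains_inf[OF compact_Icc ne cont] by blast
  obtain s2 where s2: "s2 \<in> {0..t}" "\<And>s. s \<in> {0..t} \<Longrightarrow> Y s \<omega> \<le> Y s2 \<omega>"
    using continuous_attains_sup[OF compact_Icc ne cont] by blast
  have pos: "0 < Y s1 \<omega>" using regular_path_pos[OF \<omega>(1)] s1(1) by simp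
  obtain n0 :: nat where n0: "max (Y s2 \<omega>) (1 / Y s1 \<omega>) < real n0"
    using reals_Archimedean2 by blast
  show ?thesis
  proof (rule eventually_sequentiallyI[of n0])
    fix n assume n: "n0 \<le> n"
    define u where "u = real (Suc n)"
    have u: "0 < u" "Y s2 \<omega> \<le> u" "1 / Y s1 \<omega> \<le> u" using n n0 by (auto simp: u_def)
    then have l: "1 / u \<le> Y s1 \<omega>" using pos by (simp add: field_simps)
    have lu: "0 < 1 / u" "1 / u \<le> u"
      using u(1) l s2(2)[OF s1(1)] u(2) by simp_all
    have range: "Y s \<omega> \<in> {1 / u..u}" if "s \<in> {0..t}" for s
      using s1(2)[OF that] s2(2)[OF that] l u(2) by simp
    have "\<omega> \<in> confined (1 / u) u t"
      unfolding confined_def using \<omega>(2) range t by simp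
    moreover have "Y t \<omega> \<in> {1 / u..u}" using t by (intro range) simp
    ultimately show "localized (1 / real (Suc n)) (real (Suc n)) \<phi> t \<omega> = \<phi> (Y t \<omega>)"
      unfolding u_def[symmetric] by (simp add: localized_def[OF lu] clamp_id[OF lu])
  qed
qed

theorem lyapunov_moment_bound:
  assumes t: "0 \<le> t"
  shows "(\<integral>\<^sup>+ \<omega>. ennreal (V (Y t \<omega>)) \<partial>M) \<le> ennreal (V y0 + C / \<epsilon>)"
proof -
  let ?f = "\<lambda>n. localized (1 / real (Suc n)) (real (Suc n)) V t"
  have lu: "0 < 1 / real (Suc n)" "1 / real (Suc n) \<le> real (Suc n)" for n
    by (simp_all add: divide_le_eq mult_ge1_I)
  have int: "integrable M (?f n)" for n
    by (rule localized_integrable[OF lu V_continuous t])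
  have nonneg: "0 \<le> ?f n \<omega>" for n \<omega>
    using less_imp_le[OF V_pos[OF clamp_pos[OF lu, of n]]]
    by (simp only: localized_def[OF lu] indicator_pos_le mult_nonneg_nonneg)
  have "AE \<omega> in M. ennreal (V (Y t \<omega>)) = liminf (\<lambda>n. ennreal (?f n \<omega>))"
    using AE_regular_path AE_space
  proof eventually_elim
    fix \<omega> assume \<omega>: "regular_path \<omega>" "\<omega> \<in> space M"
    have "(\<lambda>n. ennreal (?f n \<omega>)) \<longlonglongrightarrow> ennreal (V (Y t \<omega>))"
      by (rule tendsto_eventually, rule eventually_mono[OF eventually_localized_eq[OF \<omega> t, of V]]) simp
    from lim_imp_Liminf[OF sequentially_bot this]
    show "ennreal (V (Y t \<omega>)) = liminf (\<lambda>n. ennreal (?f n \<omega>))" by (rule sym)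
  qed
  then have "(\<integral>\<^sup>+ \<omega>. ennreal (V (Y t \<omega>)) \<partial>M) = (\<integral>\<^sup>+ \<omega>. liminf (\<lambda>n. ennreal (?f n \<omega>)) \<partial>M)"
    by (rule nn_integral_cong_AE)
  also have "\<dots> \<le> liminf (\<lambda>n. \<integral>\<^sup>+ \<omega>. ennreal (?f n \<omega>) \<partial>M)"
    by (intro nn_integral_liminf measurable_compose[OF borel_measurable_integrable[OF int] measurable_ennreal])
  also have "\<dots> = liminf (\<lambda>n. ennreal (expectation (?f n)))"
    using nn_integral_eq_integral[OF int AE_I2[OF nonneg]] by simp
  also have "\<dots> \<le> liminf (\<lambda>n::nat. ennreal (V y0 + C / \<epsilon>))"
    by (intro Liminf_mono always_eventually allI ennreal_leI localized_lyapunov_bound[OF lu t])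
  also have "\<dots> = ennreal (V y0 + C / \<epsilon>)"
    by (rule Liminf_const) simp
  finally show ?thesis .
qed

end

section \<open>A Lyapunov function for the drift\<close>

text \<open>For \<open>lo < hi\<close>: up to a constant, \<open>\<phi>\<close> is absorbed by any small multiple of \<open>x powr lo\<close> near \<open>0\<close> and of
  \<open>x powr hi\<close> near infinity. The bound is one-sided, since only upper bounds of \<open>\<Gamma> V\<close> matter.\<close>

definition subdominant :: "real \<Rightarrow> real \<Rightarrow> (real \<Rightarrow> real) \<Rightarrow> bool" where
  "subdominant lo hi \<phi> \<longleftrightarrow> (\<forall>\<delta>>0. \<exists>B. \<forall>x>0. \<phi> x \<le> B + \<delta> * (x powr lo + x powr hi))"

lemma subdominant_powr:
  assumes "lo < \<alpha>" "\<alpha> < hi"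
  shows "subdominant lo hi (\<lambda>x. c * x powr \<alpha>)"
  unfolding subdominant_def
proof (intro allI impI exI)
  fix \<delta> x :: real
  assume \<delta>: "0 < \<delta>" and x: "0 < x"
  \<comment> \<open>If neither power absorbs the term, both quotients are below \<open>A\<close>, and this bounds \<open>x powr \<alpha>\<close> itself.\<close>
  define A where "A = \<bar>c\<bar> / \<delta>"
  have c: "\<bar>c\<bar> = \<delta> * A" using \<delta> by (simp add: A_def)
  have A: "0 \<le> A" using \<delta> by (simp add: A_def)
  have le: "c * x powr \<alpha> \<le> \<bar>c\<bar> * x powr \<alpha>" by (intro mult_right_mono) simp_all
  let ?B = "\<bar>c\<bar> * (A powr (\<alpha> / (hi - \<alpha>)) + A powr (\<alpha> / (lo - \<alpha>)))"
  have B0: "0 \<le> ?B" by simp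
  have split: "\<delta> * (x powr lo + x powr hi) = \<delta> * x powr lo + \<delta> * x powr hi" by (rule distrib_left)
  have lohi: "0 \<le> \<delta> * x powr lo" "0 \<le> \<delta> * x powr hi" using \<delta> by simp_all
  consider "A \<le> x powr (hi - \<alpha>)" | "A \<le> x powr (lo - \<alpha>)"
    | "x powr (hi - \<alpha>) < A" "x powr (lo - \<alpha>) < A" by linarith
  then show "c * x powr \<alpha> \<le> ?B + \<delta> * (x powr lo + x powr hi)"
  proof cases
    case 1
    have "\<bar>c\<bar> * x powr \<alpha> \<le> \<delta> * (x powr (hi - \<alpha>) * x powr \<alpha>)"
      unfolding c using 1 \<delta> by (simp add: mult.assoc mult_left_mono mult_right_mono)
    also have "x powr (hi - \<alpha>) * x powr \<alpha> = x powr hi" by (simp add: powr_add[symmetric])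
    finally show ?thesis using le B0 lohi split by linarith
  next
    case 2
    have "\<bar>c\<bar> * x powr \<alpha> \<le> \<delta> * (x powr (lo - \<alpha>) * x powr \<alpha>)"
      unfolding c using 2 \<delta> by (simp add: mult.assoc mult_left_mono mult_right_mono)
    also have "x powr (lo - \<alpha>) * x powr \<alpha> = x powr lo" by (simp add: powr_add[symmetric])
    finally show ?thesis using le B0 lohi split by linarith
  next
    case 3
    have "x powr \<alpha> \<le> A powr (\<alpha> / (hi - \<alpha>)) + A powr (\<alpha> / (lo - \<alpha>))"
    proof (cases "0 \<le> \<alpha>")
      case True
      have "x powr \<alpha> = (x powr (hi - \<alpha>)) powr (\<alpha> / (hi - \<alpha>))"
        using assms by (simp add: powr_powr)
      also have "\<dots> \<le> A powr (\<alpha> / (hi - \<alpha>))"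
        using 3 True assms by (intro powr_mono2) simp_all
      finally show ?thesis by (simp add: add_increasing2)
    next
      case False
      have "x powr \<alpha> = (x powr (lo - \<alpha>)) powr (\<alpha> / (lo - \<alpha>))"
        using assms by (simp add: powr_powr)
      also have "\<dots> \<le> A powr (\<alpha> / (lo - \<alpha>))"
        using 3 False assms by (intro powr_mono2) (simp_all add: divide_nonpos_neg)
      finally show ?thesis by (simp add: add_increasing)
    qed
    then have "\<bar>c\<bar> * x powr \<alpha> \<le> ?B" by (intro mult_left_mono) simp_all
    then show ?thesis using le lohi split by linarith
  qed
qed

lemma subdominant_add:
  assumes "subdominant lo hi \<phi>" "subdominant lo hi \<psi>"
  shows "subdominant lo hi (\<lambda>x. \<phi> x + \<psi> x)"
  unfolding subdominant_def
proof (intro allI impI)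
  fix \<delta> :: real
  assume "0 < \<delta>"
  then have \<delta>: "0 < \<delta> / 2" by simp
  obtain B1 where B1: "\<And>x. 0 < x \<Longrightarrow> \<phi> x \<le> B1 + \<delta> / 2 * (x powr lo + x powr hi)"
    using assms(1) \<delta> unfolding subdominant_def by blast
  obtain B2 where B2: "\<And>x. 0 < x \<Longrightarrow> \<psi> x \<le> B2 + \<delta> / 2 * (x powr lo + x powr hi)"
    using assms(2) \<delta> unfolding subdominant_def by blast
  have "\<phi> x + \<psi> x \<le> (B1 + B2) + \<delta> * (x powr lo + x powr hi)" if "0 < x" for x
  proof -
    have "\<delta> / 2 * (x powr lo + x powr hi) + \<delta> / 2 * (x powr lo + x powr hi) = \<delta> * (x powr lo + x powr hi)"
      by (simp only: distrib_right[symmetric] field_sum_of_halves)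
    then show ?thesis using B1[OF that] B2[OF that] by linarith
  qed
  then show "\<exists>B. \<forall>x>0. \<phi> x + \<psi> x \<le> B + \<delta> * (x powr lo + x powr hi)" by blast
qed

lemma bounded_above_by_dominant_powers:
  assumes sub: "subdominant lo hi \<phi>" and \<kappa>: "0 < \<kappa>1" "0 < \<kappa>2"
    and le: "\<And>x. 0 < x \<Longrightarrow> \<psi> x \<le> \<phi> x - \<kappa>1 * x powr lo - \<kappa>2 * x powr hi"
  shows "\<exists>B\<ge>0. \<forall>x>0. \<psi> x \<le> B"
proof -
  define \<delta> where "\<delta> = min \<kappa>1 \<kappa>2"
  have "0 < \<delta>" using \<kappa> by (simp add: \<delta>_def)
  then obtain B where B: "\<And>x. 0 < x \<Longrightarrow> \<phi> x \<le> B + \<delta> * (x powr lo + x powr hi)"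
    using sub unfolding subdominant_def by blast
  have "\<psi> x \<le> \<bar>B\<bar>" if x: "0 < x" for x
  proof -
    have "\<delta> * x powr lo \<le> \<kappa>1 * x powr lo" "\<delta> * x powr hi \<le> \<kappa>2 * x powr hi"
      by (intro mult_right_mono; simp add: \<delta>_def)+
    moreover have "\<delta> * (x powr lo + x powr hi) = \<delta> * x powr lo + \<delta> * x powr hi" by (rule distrib_left)
    ultimately show ?thesis using B[OF x] le[OF x] by linarith
  qed
  then show ?thesis by (intro exI[of _ "\<bar>B\<bar>"]) simp
qed

definition powr_deriv :: "nat \<Rightarrow> real \<Rightarrow> real \<Rightarrow> real" where
  "powr_deriv k e x = (\<Prod>i<k. e - real i) * x powr (e - real k)"

lemma powr_deriv_has_derivative:
  assumes "0 < x"
  shows "(powr_deriv k e has_real_derivative powr_deriv (Suc k) e x) (at x)"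
proof -
  have "((\<lambda>x. x powr (e - real k)) has_real_derivative (e - real k) * x powr (e - real k - 1)) (at x)"
    using has_real_derivative_powr[OF assms] .
  from DERIV_cmult[OF this, of "\<Prod>i<k. e - real i"] show ?thesis
    unfolding powr_deriv_def[abs_def] by (simp add: algebra_simps)
qed

lemma powr_deriv_continuous: "continuous_on {0<..} (powr_deriv k e)"
  using powr_deriv_has_derivative
  by (intro continuous_at_imp_continuous_on ballI DERIV_isCont) simp

lemma drift_eq:
  assumes "1 < \<theta>"
  shows "drift a_m1 a0 a1 a2 b \<gamma> \<theta> x
    = (\<theta> - 1) * (a2 * x powr (- ((\<gamma> - \<theta>) / (\<theta> - 1))) - a1 * x - a_m1 * x powr (1 + 2 / (\<theta> - 1))
        + a0 * x powr (1 + 1 / (\<theta> - 1)) + b\<^sup>2 / 2 * \<theta> * inverse x)"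
proof -
  have "(\<gamma> - \<theta>) / (1 - \<theta>) = - ((\<gamma> - \<theta>) / (\<theta> - 1))"
    using minus_divide_right[of "\<gamma> - \<theta>" "\<theta> - 1"] by simp
  moreover have "(\<theta> + 1) / (\<theta> - 1) = 1 + 2 / (\<theta> - 1)" "\<theta> / (\<theta> - 1) = 1 + 1 / (\<theta> - 1)"
    using assms by (simp_all add: field_simps)
  ultimately show ?thesis by (simp add: drift_def)
qed

text \<open>The \<open>1 / x\<close> term of the drift and the noise both produce the exponent \<open>e - 2\<close>. For \<open>e = - p\<close> their
  joint coefficient is a negative multiple of \<open>1 - (\<theta> - 1) p\<close>, hence positive for large \<open>p\<close>. If
  \<open>\<gamma> + 1 = 2 \<theta>\<close>, the term with \<open>a2\<close> has the same exponent, and the upper bound on \<open>p\<close> is what keeps the sum from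
  becoming positive.\<close>

lemma generator_powr:
  fixes a_m1 a0 a1 a2 b \<gamma> \<theta> e x :: real
  assumes \<theta>: "1 < \<theta>" and x: "0 < x"
  defines "m \<equiv> (\<gamma> - \<theta>) / (\<theta> - 1)" and "s \<equiv> 1 / (\<theta> - 1)"
  shows "powr_deriv 1 e x * drift a_m1 a0 a1 a2 b \<gamma> \<theta> x
           + (b * (1 - \<theta>))\<^sup>2 / 2 * powr_deriv 2 e x
    = e * (\<theta> - 1) * a2 * x powr (e - 1 - m)
      + e * (\<theta> - 1) * (b\<^sup>2 / 2 * (1 + (\<theta> - 1) * e)) * x powr (e - 2)
      + (- e * (\<theta> - 1) * a_m1) * x powr (e + 2 * s)
      + (- e * (\<theta> - 1) * a1) * x powr e + e * (\<theta> - 1) * a0 * x powr (e + s)"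
proof -
  have d1: "powr_deriv 1 e x = e * x powr (e - 1)" by (simp add: powr_deriv_def)
  have d2: "powr_deriv 2 e x = e * (e - 1) * x powr (e - 2)"
    by (simp add: powr_deriv_def eval_nat_numeral)
  have "inverse x = x powr (- 1)" using x by (simp add: powr_minus)
  then have p: "x powr (e - 1) * x powr (- m) = x powr (e - 1 - m)"
    "x powr (e - 1) * x = x powr e"
    "x powr (e - 1) * x powr (1 + 2 * s) = x powr (e + 2 * s)"
    "x powr (e - 1) * x powr (1 + s) = x powr (e + s)"
    "x powr (e - 1) * inverse x = x powr (e - 2)"
    using powr_add[of x "e - 1" "- m"] powr_add[of x "e - 1" 1] powr_add[of x "e - 1" "1 + 2 * s"]
      powr_add[of x "e - 1" "1 + s"] powr_add[of x "e - 1" "- 1"] x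
    by simp_all
  have dr: "drift a_m1 a0 a1 a2 b \<gamma> \<theta> x
    = (\<theta> - 1) * (a2 * x powr (- m) - a1 * x - a_m1 * x powr (1 + 2 * s)
        + a0 * x powr (1 + s) + b\<^sup>2 / 2 * \<theta> * inverse x)"
    using drift_eq[OF \<theta>] by (simp add: m_def s_def)
  have "powr_deriv 1 e x * drift a_m1 a0 a1 a2 b \<gamma> \<theta> x
    = e * (\<theta> - 1) * (a2 * (x powr (e - 1) * x powr (- m)) - a1 * (x powr (e - 1) * x)
        - a_m1 * (x powr (e - 1) * x powr (1 + 2 * s)) + a0 * (x powr (e - 1) * x powr (1 + s))
        + b\<^sup>2 / 2 * \<theta> * (x powr (e - 1) * inverse x))"
    unfolding d1 dr by (simp add: algebra_simps)
  then show ?thesis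
    unfolding d2 p by (simp add: algebra_simps power2_eq_square add_divide_distrib diff_divide_distrib)
qed

text \<open>The terms of \<open>\<Gamma> V + V\<close> are grouped by origin: \<open>A\<close> from \<open>a2\<close>, \<open>B\<close> from the \<open>1 / x\<close> term and the noise, \<open>E\<close> from
  \<open>a_m1\<close>, and \<open>R\<close> collects the remaining powers. The dominating terms are \<open>E 2\<close> at infinity and, at \<open>0\<close>,
  \<open>A (- p)\<close> if \<open>\<gamma> + 1 > 2 \<theta>\<close>. If \<open>\<gamma> + 1 = 2 \<theta>\<close> the terms \<open>A\<close> and \<open>B\<close> have the same exponent; then \<open>A + B\<close> at
  \<open>- p\<close> is not positive and is dropped, and \<open>A + B\<close> at \<open>- q\<close> dominates.\<close>

lemma drift_lyapunov_condition:
  fixes a_m1 a0 a1 a2 b \<gamma> \<theta> p :: real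
  assumes pos: "0 < a_m1" "0 < a2" "0 < b" and \<theta>: "1 < \<theta>" and p: "0 < p"
    and cond: "2 * \<theta> < \<gamma> + 1 \<or> 2 * \<theta> = \<gamma> + 1 \<and> p \<le> (2 * a2 + b\<^sup>2) / ((\<theta> - 1) * b\<^sup>2)"
  defines "q \<equiv> p - min 1 (p / 2)"
  defines "V \<equiv> \<lambda>k x. powr_deriv k (- p) x + powr_deriv k (- q) x + powr_deriv k 2 x"
  shows "\<exists>C\<ge>0. \<forall>x>0. V 1 x * drift a_m1 a0 a1 a2 b \<gamma> \<theta> x + (b * (1 - \<theta>))\<^sup>2 / 2 * V 2 x \<le> C - 1 * V 0 x"
proof -
  \<comment> \<open>The two regimes are \<open>m > 1\<close> and \<open>m = 1\<close>: the term with \<open>a2\<close> is more singular than \<open>1 / x\<close> or equally so.\<close>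
  define m where "m = (\<gamma> - \<theta>) / (\<theta> - 1)"
  define s where "s = 1 / (\<theta> - 1)"
  define \<Gamma> where "\<Gamma> = (\<lambda>x. V 1 x * drift a_m1 a0 a1 a2 b \<gamma> \<theta> x + (b * (1 - \<theta>))\<^sup>2 / 2 * V 2 x + V 0 x)"
  have s: "0 < s" using \<theta> by (simp add: s_def)
  have q: "0 < q" "q < p" "p < q + 2" using p by (auto simp: q_def min_def)
  define \<beta> where "\<beta> = (\<lambda>e. b\<^sup>2 / 2 * (1 + (\<theta> - 1) * e))"
  define A where "A = (\<lambda>e x. e * (\<theta> - 1) * a2 * x powr (e - 1 - m))"
  define B where "B = (\<lambda>e x. e * (\<theta> - 1) * \<beta> e * x powr (e - 2))"
  define E where "E = (\<lambda>e x. (- e * (\<theta> - 1) * a_m1) * x powr (e + 2 * s))"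
  define R where "R = (\<lambda>e x. (1 - e * (\<theta> - 1) * a1) * x powr e + e * (\<theta> - 1) * a0 * x powr (e + s))"
  have \<Gamma>_eq: "\<Gamma> x = (A (- p) x + B (- p) x + E (- p) x + R (- p) x)
      + (A (- q) x + B (- q) x + E (- q) x + R (- q) x) + (A 2 x + B 2 x + E 2 x + R 2 x)"
    if x: "0 < x" for x
  proof -
    have gen: "powr_deriv 1 e x * drift a_m1 a0 a1 a2 b \<gamma> \<theta> x + (b * (1 - \<theta>))\<^sup>2 / 2 * powr_deriv 2 e x
        + powr_deriv 0 e x = A e x + B e x + E e x + R e x" for e
      using generator_powr[OF \<theta> x, of e a_m1 a0 a1 a2 b \<gamma>]
      by (simp add: A_def B_def E_def R_def \<beta>_def m_def s_def powr_deriv_def[of 0] left_diff_distrib)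
    show ?thesis
      unfolding \<Gamma>_def V_def gen[symmetric] by (simp add: algebra_simps)
  qed
  have subA: "subdominant lo hi (A e)" if "lo < e - 1 - m" "e - 1 - m < hi" for lo hi e
    unfolding A_def using that by (rule subdominant_powr)
  have subB: "subdominant lo hi (B e)" if "lo < e - 2" "e - 2 < hi" for lo hi e
    unfolding B_def using that by (rule subdominant_powr)
  have subE: "subdominant lo hi (E e)" if "lo < e + 2 * s" "e + 2 * s < hi" for lo hi e
    unfolding E_def using that by (rule subdominant_powr)
  have subR: "subdominant lo hi (R e)" if "lo < e" "e + s < hi" for lo hi e
    unfolding R_def using that s by (intro subdominant_add subdominant_powr) simp_all
  have E2: "E 2 x = - (2 * (\<theta> - 1) * a_m1 * x powr (2 + 2 * s))" for x
    by (simp add: E_def)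
  have k2: "0 < 2 * (\<theta> - 1) * a_m1" using \<theta> pos by simp
  have "\<exists>C\<ge>0. \<forall>x>0. \<Gamma> x \<le> C"
    using cond
  proof
    assume "2 * \<theta> < \<gamma> + 1"
    then have m: "1 < m" using \<theta> by (simp add: m_def)
    show ?thesis
    proof (rule bounded_above_by_dominant_powers)
      show "subdominant (- p - 1 - m) (2 + 2 * s) (\<lambda>x. (B (- p) x + E (- p) x + R (- p) x)
          + (A (- q) x + B (- q) x + E (- q) x + R (- q) x) + (A 2 x + B 2 x + R 2 x))"
        by (intro subdominant_add subA subB subE subR; use p q m s in linarith)
      show "0 < p * (\<theta> - 1) * a2" using p \<theta> pos by simp
      show "0 < 2 * (\<theta> - 1) * a_m1" by (rule k2)
      fix x :: real
      assume x: "0 < x"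
      have "A (- p) x = - (p * (\<theta> - 1) * a2 * x powr (- p - 1 - m))" by (simp add: A_def)
      then show "\<Gamma> x \<le> (B (- p) x + E (- p) x + R (- p) x)
          + (A (- q) x + B (- q) x + E (- q) x + R (- q) x) + (A 2 x + B 2 x + R 2 x)
          - p * (\<theta> - 1) * a2 * x powr (- p - 1 - m) - 2 * (\<theta> - 1) * a_m1 * x powr (2 + 2 * s)"
        unfolding \<Gamma>_eq[OF x] E2 by simp
    qed
  next
    assume eq: "2 * \<theta> = \<gamma> + 1 \<and> p \<le> (2 * a2 + b\<^sup>2) / ((\<theta> - 1) * b\<^sup>2)"
    have "\<gamma> - \<theta> = \<theta> - 1" using eq by linarith
    then have m: "m = 1" using \<theta> by (simp add: m_def)
    \<comment> \<open>This is nonnegative exactly up to the critical value of \<open>r\<close>, and \<open>q < p\<close> makes it positive at \<open>q\<close>.\<close>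
    have coeff: "a2 + \<beta> (- r) = (2 * a2 + b\<^sup>2 - r * ((\<theta> - 1) * b\<^sup>2)) / 2" for r
      by (simp add: \<beta>_def field_simps)
    have \<theta>b: "0 < (\<theta> - 1) * b\<^sup>2" using \<theta> pos by simp
    have pb: "p * ((\<theta> - 1) * b\<^sup>2) \<le> 2 * a2 + b\<^sup>2" using eq \<theta>b by (simp add: pos_le_divide_eq)
    have cp: "0 \<le> a2 + \<beta> (- p)" using pb by (simp add: coeff)
    have "q * ((\<theta> - 1) * b\<^sup>2) < p * ((\<theta> - 1) * b\<^sup>2)" using q(2) \<theta>b by (rule mult_strict_right_mono)
    then have cq: "0 < a2 + \<beta> (- q)" using pb by (simp add: coeff)
    have AB: "A (- r) x + B (- r) x = - (r * (\<theta> - 1) * (a2 + \<beta> (- r)) * x powr (- r - 2))" for r x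
      by (simp add: A_def B_def m algebra_simps)
    show ?thesis
    proof (rule bounded_above_by_dominant_powers)
      show "subdominant (- q - 2) (2 + 2 * s) (\<lambda>x. (E (- p) x + R (- p) x)
          + (E (- q) x + R (- q) x) + (A 2 x + B 2 x + R 2 x))"
        by (intro subdominant_add subA subB subE subR; use p q m s in linarith)
      show "0 < q * (\<theta> - 1) * (a2 + \<beta> (- q))" using q(1) \<theta> cq by simp
      show "0 < 2 * (\<theta> - 1) * a_m1" by (rule k2)
      fix x :: real
      assume x: "0 < x"
      have "0 \<le> p * (\<theta> - 1) * (a2 + \<beta> (- p)) * x powr (- p - 2)" using p \<theta> cp by simp
      then show "\<Gamma> x \<le> (E (- p) x + R (- p) x) + (E (- q) x + R (- q) x) + (A 2 x + B 2 x + R 2 x)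
          - q * (\<theta> - 1) * (a2 + \<beta> (- q)) * x powr (- q - 2) - 2 * (\<theta> - 1) * a_m1 * x powr (2 + 2 * s)"
        using AB[of p x] AB[of q x] unfolding \<Gamma>_eq[OF x] E2 by linarith
    qed
  qed
  then show ?thesis unfolding \<Gamma>_def by (simp add: le_diff_eq)
qed

section \<open>Negative moments of the solution\<close>

theorem lemma1:
  fixes M :: "'a measure" and F :: "real \<Rightarrow> 'a measure"
    and W Y :: "real \<Rightarrow> 'a \<Rightarrow> real"
    and a_m1 a0 a1 a2 b \<gamma> \<theta> x0 p :: real
  assumes "brownian_motion M F W"
    and "a_m1 > 0" "a0 > 0" "a1 > 0" "a2 > 0" "b > 0"
    and "\<gamma> > 1" "\<theta> > 1" "x0 > 0"
    and "positive_global_solution M F W (drift a_m1 a0 a1 a2 b \<gamma> \<theta>) (b * (1 - \<theta>))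
           (x0 powr (1 - \<theta>)) Y"
    and "(\<gamma> + 1 > 2 * \<theta> \<and> p \<ge> 2 / (\<theta> - 1)) \<or>
         (\<gamma> + 1 = 2 * \<theta> \<and> 2 / (\<theta> - 1) \<le> p \<and> p \<le> (2 * a2 + b\<^sup>2) / ((\<theta> - 1) * b\<^sup>2))"
  shows "(SUP t\<in>{0..}. \<integral>\<^sup>+ \<omega>. ennreal (\<bar>Y t \<omega>\<bar> powr (- p)) \<partial>M) < \<infinity>"
proof -
  have "0 < 2 / (\<theta> - 1)" using \<open>\<theta> > 1\<close> by simp
  then have p: "0 < p" using assms(11) by linarith
  define q where "q = p - min 1 (p / 2)"
  define V where "V = (\<lambda>k x. powr_deriv k (- p) x + powr_deriv k (- q) x + powr_deriv k 2 x)"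
  have cond: "2 * \<theta> < \<gamma> + 1 \<or> 2 * \<theta> = \<gamma> + 1 \<and> p \<le> (2 * a2 + b\<^sup>2) / ((\<theta> - 1) * b\<^sup>2)"
    using assms(11) by auto
  obtain C where C: "0 \<le> C"
    "\<And>x. 0 < x \<Longrightarrow> V 1 x * drift a_m1 a0 a1 a2 b \<gamma> \<theta> x + (b * (1 - \<theta>))\<^sup>2 / 2 * V 2 x \<le> C - 1 * V 0 x"
    using drift_lyapunov_condition[OF \<open>a_m1 > 0\<close> \<open>a2 > 0\<close> \<open>b > 0\<close> \<open>\<theta> > 1\<close> p cond]
    unfolding V_def q_def by blast
  have V_deriv: "(V k has_real_derivative V (Suc k) x) (at x)" if "0 < x" for k x
    unfolding V_def by (intro DERIV_add powr_deriv_has_derivative that)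
  interpret brownian_motion M F W by fact
  interpret lyapunov_diffusion M F W "drift a_m1 a0 a1 a2 b \<gamma> \<theta>" "b * (1 - \<theta>)" "x0 powr (1 - \<theta>)" Y
    "V 0" "V 1" "V 2" "V 3" C 1
  proof
    show "positive_global_solution M F W (drift a_m1 a0 a1 a2 b \<gamma> \<theta>) (b * (1 - \<theta>)) (x0 powr (1 - \<theta>)) Y"
      by fact
    show "0 < x0 powr (1 - \<theta>)" using \<open>x0 > 0\<close> by simp
    show "continuous_on {0<..} (drift a_m1 a0 a1 a2 b \<gamma> \<theta>)"
      unfolding drift_def[abs_def] by (intro continuous_intros) auto
    show "0 < V 0 x" if "0 < x" for x
      unfolding V_def powr_deriv_def using that by (simp add: add_pos_pos)
    show "(V 0 has_real_derivative V 1 x) (at x)" if "0 < x" for x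
      using V_deriv[OF that, of 0] by simp
    show "(V 1 has_real_derivative V 2 x) (at x)" if "0 < x" for x
      using V_deriv[OF that, of 1] by (simp add: numeral_2_eq_2)
    show "(V 2 has_real_derivative V 3 x) (at x)" if "0 < x" for x
      using V_deriv[OF that, of 2] by (simp add: eval_nat_numeral)
    show "continuous_on {0<..} (V 3)"
      unfolding V_def by (intro continuous_on_add powr_deriv_continuous)
  qed (use C in auto)
  have "(\<integral>\<^sup>+ \<omega>. ennreal (\<bar>Y t \<omega>\<bar> powr (- p)) \<partial>M) \<le> ennreal (V 0 (x0 powr (1 - \<theta>)) + C / 1)"
    if t: "t \<in> {0..}" for t
  proof -
    have "AE \<omega> in M. ennreal (\<bar>Y t \<omega>\<bar> powr (- p)) \<le> ennreal (V 0 (Y t \<omega>))"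
      using AE_regular_path
    proof eventually_elim
      fix \<omega> assume "regular_path \<omega>"
      then have "0 < Y t \<omega>" using t by (intro regular_path_pos) simp_all
      then show "ennreal (\<bar>Y t \<omega>\<bar> powr (- p)) \<le> ennreal (V 0 (Y t \<omega>))"
        unfolding V_def powr_deriv_def by (intro ennreal_leI) simp
    qed
    then have "(\<integral>\<^sup>+ \<omega>. ennreal (\<bar>Y t \<omega>\<bar> powr (- p)) \<partial>M) \<le> (\<integral>\<^sup>+ \<omega>. ennreal (V 0 (Y t \<omega>)) \<partial>M)"
      by (rule nn_integral_mono_AE)
    also have "\<dots> \<le> ennreal (V 0 (x0 powr (1 - \<theta>)) + C / 1)"
      using t by (intro lyapunov_moment_bound) simp
    finally show ?thesis .
  qed
  then have "(SUP t\<in>{0..}. \<integral>\<^sup>+ \<omega>. ennreal (\<bar>Y t \<omega>\<bar> powr (- p)) \<partial>M)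
      \<le> ennreal (V 0 (x0 powr (1 - \<theta>)) + C / 1)"
    by (rule SUP_least)
  then show ?thesis by (rule le_less_trans) simp
qed

end
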